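(* Consider the problem of minimizing $J(x(\cdot))=\int_{t_0}^{t_1}L(t,x(t),\dot x(t))\,dt$ over $x(\cdot)\in KC^1(I,\mathbb R^n)$ with $x(t_0)=x_0$, $x(t_1)=x_1$. Let the functions $L$ and $L_{\dot x}$ be twice continuously differentiable in the totality of their variables, and let the admissible function $\bar x(\cdot)$ be a weak local minimum in this problem. Then there exists $\delta>0$ for which the following statements are valid: (j) If at the point $\theta\in[t_0,t_1)$ (respectively $\theta\in(t_0,t_1]$) the function $\bar x(\cdot)$ is triply differentiable on the right (left) in a semi-neighborhood $[\theta,\theta+\alpha)\subset I$ (respectively $(\theta-\alpha,\theta]\subset I$), $\alpha>0$, of $\theta$, then for every point $\big(\eta,(\bar\lambda-1)^{-1}\bar\lambda\eta,\bar\lambda\big)\in B_\delta(0)\times B_\delta(0)\times(0,1)$ satisfying $$E(\bar L)(\theta+,\eta)=E(\bar L)\big(\theta+,(\bar\lambda-1)^{-1}\bar\lambda\eta\big)=0\quad\text{and}\quad W(\bar L)(\theta+,\bar\lambda,\eta)=0$$ $$\Big(\text{respectively } E(\bar L)(\theta-,\eta)=E(\bar L)\big(\theta-,(\bar\lambda-1)^{-1}\bar\lambda\eta\big)=0\quad\text{and}\quad W(\bar L)(\theta-,\bar\lambda,\eta)=0\Big)$$ one has $G(\bar L)(\theta+,\bar\lambda,\eta)\ge0$ (respectively $G(\bar L)(\theta-,\bar\lambda,\eta)\ge0$). (jj) If at the point $\theta\in(t_0,t_1)$ the function $\bar x(\cdot)$ is triply differentiable, then for every point $\big(\eta,(\bar\lambda-1)^{-1}\bar\lambda\eta,\bar\lambda\big)\in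 B_\delta(0)\times B_\delta(0)\times(0,1)$ satisfying $$E(\bar L)(\theta,\eta)=E(\bar L)\big(\theta,(\bar\lambda-1)^{-1}\bar\lambda\eta\big)=0$$ one has $G(\bar L)(\theta,\bar\lambda,\eta)\ge0$.
   Context: Setting. $(a,b)\subset\mathbb R$ is an interval, $I:=[t_0,t_1]\subset(a,b)$ with $t_0<t_1$, $x_0,x_1\in\mathbb R^n$, and $L=L(t,x,\dot x):(a,b)\times\mathbb R^n\times\mathbb R^n\to\mathbb R$ is continuously differentiable in the totality of variables; $L_x,L_{\dot x}$ are its partial gradients (column vectors) with respect to the second and third arguments, $L_{xx}$ the Hessian in the second argument; $T$ denotes transposition; $B_\delta(0)$ is the closed ball of radius $\delta$ centered at $0\in\mathbb R^n$. $KC^1(I,\mathbb R^n)$ is the set of piecewise-smooth functions: continuous functions $x:I\to\mathbb R^n$ whose derivative is continuous on $I$ except at finitely many points of $(t_0,t_1)$ (angular points), where $\dot x$ has discontinuities of the first kind (finite one-sided limits); at $t_0$ and $t_1$ the right, respectively left, values of $\dot x$ are finite. A function $x(\cdot)\in KC^1(I,\mathbb R^n)$ with $x(t_0)=x_0$, $x(t_1)=x_1$ is called admissible. An admissible $\bar x(\cdot)$ is a weak local minimum if there is $\hat\delta>0$ such that $J(x(\cdot))\ge J(\bar x(\cdot))$ for all admissible $x(\cdot)$ with $\max\{\|x(\cdot)-\bar x(\cdot)\|_{C(I,\mathbb R^n)},\|\dot x(\cdot)-\dot{\bar x}(\cdot)\|_{L_\infty(I,\mathbb R^n)}\}\le\hat\delta$.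 Notation along $\bar x(\cdot)$, for $\xi\in\mathbb R^n$, $\lambda\in[0,1)$: $\bar L(t)=L(t,\bar x(t),\dot{\bar x}(t))$, $\bar L_x(t)=L_x(t,\bar x(t),\dot{\bar x}(t))$, $\bar L_{\dot x}(t)=L_{\dot x}(t,\bar x(t),\dot{\bar x}(t))$, $\bar L_{xx}(t,\xi)=L_{xx}(t,\bar x(t),\dot{\bar x}(t)+\xi)$, $$E(\bar L)(t,\xi)=L(t,\bar x(t),\dot{\bar x}(t)+\xi)-\bar L(t)-\bar L_{\dot x}^T(t)\xi,\qquad \Delta\bar L_x(t,\xi)=L_x(t,\bar x(t),\dot{\bar x}(t)+\xi)-\bar L_x(t),$$ $$Q_i(\bar L)(t,\lambda,\xi)=\lambda^iE(\bar L)(t,\xi)+(1-\lambda^i)E(\bar L)\Big(t,\tfrac{\lambda}{\lambda-1}\xi\Big),\quad i=1,2,3,$$ $$M_i(\bar L_x)(t,\lambda,\xi)=\lambda^i\Delta\bar L_x^T(t,\xi)\xi+(1-\lambda)\big(\tfrac12+\lambda\big)^{i-1}\Delta\bar L_x^T\Big(t,\tfrac{\lambda}{\lambda-1}\xi\Big)\xi,\quad i=1,2,$$ $$W(\bar L)(t,\lambda,\xi)=\lambda M_1(\bar L_x)(t,\lambda,\xi)+\frac{d}{dt}Q_2(\bar L)(t,\lambda,\xi),$$ $$G(\bar L)(t,\lambda,\xi)=\lambda^2\xi^T\Big[\lambda\bar L_{xx}(t,\xi)+(1-\lambda)\bar L_{xx}\Big(t,\tfrac{\lambda}{\lambda-1}\xi\Big)\Big]\xi+2\lambda\frac{d}{dt}M_2(\bar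 L_x)(t,\lambda,\xi)+\frac{d^2}{dt^2}Q_3(\bar L)(t,\lambda,\xi).$$ One-sided values: $F(\theta+)$ (resp. $F(\theta-)$) is the right-hand (left-hand) limit of $F$ at $\theta$; for functions not involving $\frac{d}{dt}$ it is obtained by using $\dot{\bar x}(\theta+)$ (resp. $\dot{\bar x}(\theta-)$) in place of $\dot{\bar x}(\theta)$. In $W(\bar L)(\theta\pm,\cdot)$ and $G(\bar L)(\theta\pm,\cdot)$ the derivatives $\frac{d}{dt},\frac{d^2}{dt^2}$ are the corresponding one-sided derivatives at $\theta$ in $t$ (other arguments fixed). *)

theory Defs
  imports "HOL-Analysis.Analysis" "HOL-Probability.Essential_Supremum"
begin

(* Continuous differentiability of order k, by recursion over all directional derivatives.
   For finite-dimensional 'a and open S this is the usual class C^k. *)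
fun Ck_on :: "nat \<Rightarrow> ('a::euclidean_space \<Rightarrow> 'b::real_normed_vector) \<Rightarrow> 'a set \<Rightarrow> bool" where
  "Ck_on 0 f S \<longleftrightarrow> continuous_on S f"
| "Ck_on (Suc k) f S \<longleftrightarrow>
     (\<forall>p\<in>S. f differentiable (at p)) \<and>
     (\<forall>h. Ck_on k (\<lambda>p. frechet_derivative f (at p) h) S)"

definition gradient :: "('a::real_inner \<Rightarrow> real) \<Rightarrow> 'a \<Rightarrow> 'a" where
  "gradient f p = (THE D. GDERIV f p :> D)"

(* Integrands are curried as L t x v, with v in the place of the velocity. *)
type_synonym 'n lagrangian = "real \<Rightarrow> real^'n \<Rightarrow> real^'n \<Rightarrow> real"

definition L_x :: "'n::finite lagrangian \<Rightarrow> real \<Rightarrow> real^'n \<Rightarrow> real^'n \<Rightarrow> real^'n" where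
  "L_x L t x v = gradient (\<lambda>y. L t y v) x"

definition L_v :: "'n::finite lagrangian \<Rightarrow> real \<Rightarrow> real^'n \<Rightarrow> real^'n \<Rightarrow> real^'n" where
  "L_v L t x v = gradient (\<lambda>w. L t x w) v"

definition L_xx :: "'n::finite lagrangian \<Rightarrow> real \<Rightarrow> real^'n \<Rightarrow> real^'n \<Rightarrow> real^'n^'n" where
  "L_xx L t x v = jacobian (\<lambda>y. L_x L t y v) (at x)"

(* The derivative of f relative to T, one-sided at those endpoints of T that belong to T. *)
definition ddt :: "real set \<Rightarrow> (real \<Rightarrow> 'a::real_normed_vector) \<Rightarrow> real \<Rightarrow> 'a" where
  "ddt T f t = vector_derivative f (at t within T)"

(* Functions on I are total functions of which only the values on I = {t0..t1} matter. *)
definition KC1 :: "real \<Rightarrow> real \<Rightarrow> (real \<Rightarrow> 'a::real_normed_vector) \<Rightarrow> bool" where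
  "KC1 t0 t1 x \<longleftrightarrow>
     continuous_on {t0..t1} x \<and>
     (\<exists>S. finite S \<and> S \<subseteq> {t0<..<t1} \<and>
        (\<forall>t\<in>{t0..t1} - S. x differentiable (at t within {t0..t1})) \<and>
        continuous_on ({t0..t1} - S) (ddt {t0..t1} x) \<and>
        (\<forall>s\<in>S. (\<exists>l. (ddt {t0..t1} x \<longlongrightarrow> l) (at_left s)) \<and>
               (\<exists>r. (ddt {t0..t1} x \<longlongrightarrow> r) (at_right s))))"

definition admissible ::
  "real \<Rightarrow> real \<Rightarrow> 'a::real_normed_vector \<Rightarrow> 'a \<Rightarrow> (real \<Rightarrow> 'a) \<Rightarrow> bool" where
  "admissible t0 t1 x0 x1 x \<longleftrightarrow> KC1 t0 t1 x \<and> x t0 = x0 \<and> x t1 = x1"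

definition J :: "'n::finite lagrangian \<Rightarrow> real \<Rightarrow> real \<Rightarrow> (real \<Rightarrow> real^'n) \<Rightarrow> real" where
  "J L t0 t1 x = integral {t0..t1} (\<lambda>t. L t (x t) (ddt {t0..t1} x t))"

definition C_norm :: "real \<Rightarrow> real \<Rightarrow> (real \<Rightarrow> 'a::real_normed_vector) \<Rightarrow> ereal" where
  "C_norm t0 t1 f = (SUP t\<in>{t0..t1}. ereal (norm (f t)))"

definition Linf_norm :: "real \<Rightarrow> real \<Rightarrow> (real \<Rightarrow> 'a::real_normed_vector) \<Rightarrow> ereal" where
  "Linf_norm t0 t1 f = esssup (lebesgue_on {t0..t1}) (\<lambda>t. ereal (norm (f t)))"

definition weak_local_min ::
  "'n::finite lagrangian \<Rightarrow> real \<Rightarrow> real \<Rightarrow> real^'n \<Rightarrow> real^'n \<Rightarrow> (real \<Rightarrow> real^'n) \<Rightarrow> bool" where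
  "weak_local_min L t0 t1 x0 x1 xb \<longleftrightarrow>
     admissible t0 t1 x0 x1 xb \<and>
     (\<exists>\<delta>>0. \<forall>x. admissible t0 t1 x0 x1 x \<longrightarrow>
        max (C_norm t0 t1 (\<lambda>t. x t - xb t))
            (Linf_norm t0 t1 (\<lambda>t. ddt {t0..t1} x t - ddt {t0..t1} xb t)) \<le> ereal \<delta> \<longrightarrow>
        J L t0 t1 x \<ge> J L t0 t1 xb)"

(* The functions along a trajectory x take the velocity v as a separate argument, so that at an
   angular point theta its value can be replaced by a one-sided limit; T is the set on which
   d/dt is taken: {theta..} and {..theta} give the one-sided derivatives at theta, UNIV the
   ordinary ones. *)
definition E_fun :: "'n::finite lagrangian \<Rightarrow> (real \<Rightarrow> real^'n) \<Rightarrow> (real \<Rightarrow> real^'n) \<Rightarrow>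
    real \<Rightarrow> real^'n \<Rightarrow> real" where
  "E_fun L x v t \<xi> = L t (x t) (v t + \<xi>) - L t (x t) (v t) - L_v L t (x t) (v t) \<bullet> \<xi>"

definition Delta_L_x :: "'n::finite lagrangian \<Rightarrow> (real \<Rightarrow> real^'n) \<Rightarrow> (real \<Rightarrow> real^'n) \<Rightarrow>
    real \<Rightarrow> real^'n \<Rightarrow> real^'n" where
  "Delta_L_x L x v t \<xi> = L_x L t (x t) (v t + \<xi>) - L_x L t (x t) (v t)"

definition Q_fun :: "nat \<Rightarrow> 'n::finite lagrangian \<Rightarrow> (real \<Rightarrow> real^'n) \<Rightarrow> (real \<Rightarrow> real^'n) \<Rightarrow>
    real \<Rightarrow> real \<Rightarrow> real^'n \<Rightarrow> real" where
  "Q_fun i L x v t lam \<xi> =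
     lam ^ i * E_fun L x v t \<xi> +
     (1 - lam ^ i) * E_fun L x v t ((lam / (lam - 1)) *\<^sub>R \<xi>)"

definition M_fun :: "nat \<Rightarrow> 'n::finite lagrangian \<Rightarrow> (real \<Rightarrow> real^'n) \<Rightarrow> (real \<Rightarrow> real^'n) \<Rightarrow>
    real \<Rightarrow> real \<Rightarrow> real^'n \<Rightarrow> real" where
  "M_fun i L x v t lam \<xi> =
     lam ^ i * (Delta_L_x L x v t \<xi> \<bullet> \<xi>) +
     (1 - lam) * (1/2 + lam) ^ (i - 1) *
       (Delta_L_x L x v t ((lam / (lam - 1)) *\<^sub>R \<xi>) \<bullet> \<xi>)"

definition W_fun :: "real set \<Rightarrow> 'n::finite lagrangian \<Rightarrow> (real \<Rightarrow> real^'n) \<Rightarrow>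
    (real \<Rightarrow> real^'n) \<Rightarrow> real \<Rightarrow> real \<Rightarrow> real^'n \<Rightarrow> real" where
  "W_fun T L x v t lam \<xi> =
     lam * M_fun 1 L x v t lam \<xi> + ddt T (\<lambda>s. Q_fun 2 L x v s lam \<xi>) t"

definition G_fun :: "real set \<Rightarrow> 'n::finite lagrangian \<Rightarrow> (real \<Rightarrow> real^'n) \<Rightarrow>
    (real \<Rightarrow> real^'n) \<Rightarrow> real \<Rightarrow> real \<Rightarrow> real^'n \<Rightarrow> real" where
  "G_fun T L x v t lam \<xi> =
     lam\<^sup>2 * (\<xi> \<bullet> ((lam *\<^sub>R L_xx L t (x t) (v t + \<xi>) +
                   (1 - lam) *\<^sub>R L_xx L t (x t) (v t + (lam / (lam - 1)) *\<^sub>R \<xi>)) *v \<xi>)) +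
     2 * lam * ddt T (\<lambda>s. M_fun 2 L x v s lam \<xi>) t +
     ddt T (ddt T (\<lambda>s. Q_fun 3 L x v s lam \<xi>)) t"

(* v with its value at theta replaced by v(theta+), respectively v(theta-). *)
definition right_val :: "(real \<Rightarrow> 'a::t2_space) \<Rightarrow> real \<Rightarrow> real \<Rightarrow> 'a" where
  "right_val v \<theta> = v(\<theta> := Lim (at_right \<theta>) v)"

definition left_val :: "(real \<Rightarrow> 'a::t2_space) \<Rightarrow> real \<Rightarrow> real \<Rightarrow> 'a" where
  "left_val v \<theta> = v(\<theta> := Lim (at_left \<theta>) v)"

definition thrice_differentiable_on ::
  "(real \<Rightarrow> 'a::real_normed_vector) \<Rightarrow> real set \<Rightarrow> bool" where
  "thrice_differentiable_on x T \<longleftrightarrow>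
     (\<exists>d1 d2 d3. \<forall>t\<in>T.
        (x has_vector_derivative d1 t) (at t within T) \<and>
        (d1 has_vector_derivative d2 t) (at t within T) \<and>
        (d2 has_vector_derivative d3 t) (at t within T))"

(* The third derivative is only required at theta itself. *)
definition thrice_differentiable_at ::
  "(real \<Rightarrow> 'a::real_normed_vector) \<Rightarrow> real \<Rightarrow> bool" where
  "thrice_differentiable_at x \<theta> \<longleftrightarrow>
     (\<exists>d1 d2 d3.
        (\<forall>\<^sub>F t in nhds \<theta>. (x has_vector_derivative d1 t) (at t) \<and>
                         (d1 has_vector_derivative d2 t) (at t)) \<and>
        (d2 has_vector_derivative d3) (at \<theta>))"

end

theory Submission
  imports Defs
begin

text \<open>
  For small \<open>\<epsilon> \<noteq> 0\<close> of either sign perturb the minimizer by the hat \<open>h\<close> that vanishes at \<open>\<theta>\<close> and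
  \<open>\<theta> + \<epsilon>\<close>, has slope \<open>\<eta>\<close> between \<open>\<theta>\<close> and \<open>\<theta> + \<lambda>\<epsilon>\<close>, and slope \<open>\<lambda>\<eta> / (\<lambda> - 1)\<close> between
  \<open>\<theta> + \<lambda>\<epsilon>\<close> and \<open>\<theta> + \<epsilon>\<close>. Since \<open>\<mu> h\<close> is an admissible perturbation for \<open>\<bar>\<mu>\<bar> \<le> 1\<close>, the first
  variation of \<open>J\<close> along \<open>h\<close> vanishes, and subtracting it from the increment of \<open>J\<close> leaves a nonnegative
  integral over the support of \<open>h\<close>, without any use of the Euler equation. A Taylor expansion about
  \<open>\<theta>\<close> gives it the value
  \<open>sgn \<epsilon> * (\<epsilon> Q\<^sub>1 + \<epsilon>^2 W / 2 + \<epsilon>^3 G / 6) + o(\<epsilon>^3)\<close>,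
  where \<open>Q\<^sub>1 = 0\<close> because both excesses vanish. Hence \<open>W = 0\<close> implies \<open>G \<ge> 0\<close>; and if both signs of
  \<open>\<epsilon>\<close> are available, then \<open>W = 0\<close> holds by itself.
\<close>

text \<open>Only two derivatives of \<open>L\<close> are at hand, so the integrand has no
  third-order Taylor expansion. None is needed: the hat lives on an interval of length
  \<open>\<bar>\<epsilon>\<bar>\<close>, and integration gains one order, so a second-order
  expansion with a remainder uniform on the hat is enough. If \<open>\<rho> *\<^sub>R \<eta>\<close>
  is the displacement and \<open>\<xi>\<close> the slope, removing the linear part of the increment
  leaves the excess at \<open>\<xi>\<close>, plus \<open>\<rho>\<close> times the increment of
  \<open>L_x\<close> contracted with \<open>\<eta>\<close>, plus half of
  \<open>\<rho>\<^sup>2\<close> times the quadratic form of \<open>L_xx\<close>. The excess is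
  expanded to second order in time, the next term to first order, the last is frozen; this is why
  the three terms of \<open>G_fun\<close> carry two, one and no time derivatives. The excess
  contains \<open>L_v\<close>, which therefore must be twice differentiable too. The slopes do not
  shrink with \<open>\<epsilon>\<close>; the variation is weak only because \<open>\<eta>\<close>
  and \<open>\<lambda>\<eta> / (\<lambda> - 1)\<close> lie in the ball. So \<open>\<delta>\<close>
  can be the radius of weak minimality itself. The second slope is forced by the return of the hat
  to zero.\<close>

section \<open>Gradients, second-order Taylor formulas and composition with a path\<close>

lemma gradient_eqI:
  fixes f :: "'a::real_inner \<Rightarrow> real"
  assumes "GDERIV f p :> D"
  shows "gradient f p = D"
  unfolding gradient_def
proof (rule the_equality)
  show "GDERIV f p :> D" by (fact assms)
next
  fix D' assume "GDERIV f p :> D'"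
  then have "(\<lambda>h. h \<bullet> D') = (\<lambda>h. h \<bullet> D)"
    using assms unfolding gderiv_def by (rule has_derivative_unique)
  then show "D' = D"
    by (metis vector_eq_ldot)
qed

text \<open>\<open>gradient\<close> is a definite description, so a witness has to be produced: the
  Riesz representative of the derivative, assembled from its values on the basis.\<close>

lemma inner_gradient:
  fixes f :: "'a::euclidean_space \<Rightarrow> real"
  assumes "(f has_derivative f') (at p)"
  shows "gradient f p \<bullet> h = f' h"
proof -
  define D where "D = (\<Sum>b\<in>Basis. f' b *\<^sub>R b)"
  have "linear f'"
    using assms by (rule has_derivative_linear)
  then have *: "f' h = h \<bullet> D" for h
    using linear_sum[of f' "\<lambda>b. (h \<bullet> b) *\<^sub>R b" Basis]
    by (simp add: D_def inner_sum_right linear_cmul euclidean_representation mult.commute)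
  then have "f' = (\<lambda>h. h \<bullet> D)"
    by blast
  then have "gradient f p = D"
    using assms by (intro gradient_eqI) (simp add: gderiv_def)
  then show ?thesis
    by (simp add: * inner_commute)
qed

text \<open>The second derivative exists at \<open>\<theta>\<close> only, which rules out a Lagrange
  remainder. Instead, differentiability of \<open>e1\<close> at \<open>\<theta>\<close> bounds the
  derivative of the remainder by \<open>\<kappa> * \<bar>t - \<theta>\<bar>\<close>, and the mean
  value inequality supplies the second factor. Derivatives are relative to a convex
  \<open>S\<close>, so that one-sided neighborhoods are covered.\<close>

lemma Peano_second_order:
  fixes e e1 :: "real \<Rightarrow> real"
  assumes S: "convex S" "\<theta> \<in> S"
    and e: "\<And>t. t \<in> S \<Longrightarrow> (e has_vector_derivative e1 t) (at t within S)"
    and e1: "(e1 has_vector_derivative e2) (at \<theta> within S)"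
    and "\<kappa> > 0"
  obtains r where "r > 0"
    "\<And>t. t \<in> S \<Longrightarrow> \<bar>t - \<theta>\<bar> < r \<Longrightarrow>
      \<bar>e t - (e \<theta> + e1 \<theta> * (t - \<theta>) + e2 * (t - \<theta>)\<^sup>2 / 2)\<bar> \<le> \<kappa> * (t - \<theta>)\<^sup>2"
proof -
  obtain r where "r > 0" and r: "\<And>t. t \<in> S \<Longrightarrow> \<bar>t - \<theta>\<bar> < r \<Longrightarrow>
      \<bar>e1 t - e1 \<theta> - (t - \<theta>) * e2\<bar> \<le> \<kappa> * \<bar>t - \<theta>\<bar>"
    using e1 \<open>\<kappa> > 0\<close> unfolding has_vector_derivative_def has_derivative_within_alt by fastforce
  have "\<bar>e t - (e \<theta> + e1 \<theta> * (t - \<theta>) + e2 * (t - \<theta>)\<^sup>2 / 2)\<bar> \<le> \<kappa> * (t - \<theta>)\<^sup>2"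
    if t: "t \<in> S" "\<bar>t - \<theta>\<bar> < r" for t
  proof -
    \<comment> \<open>\<open>C\<close> is convex, contains \<open>\<theta>\<close> and
      \<open>t\<close>, and all its points are at least as close to \<open>\<theta>\<close> as
      \<open>t\<close>, so one constant bounds the derivative on it.\<close>
    define C where "C = S \<inter> cball \<theta> \<bar>t - \<theta>\<bar>"
    define g where "g = (\<lambda>u. e u - (e1 \<theta> * (u - \<theta>) + e2 * (u - \<theta>)\<^sup>2 / 2))"
    have "norm (g t - g \<theta>) \<le> \<kappa> * \<bar>t - \<theta>\<bar> * norm (t - \<theta>)"
    proof (rule field_differentiable_bound[where S = C and f' = "\<lambda>u. e1 u - (e1 \<theta> + e2 * (u - \<theta>))"])
      show "convex C"
        unfolding C_def using S by (intro convex_Int) auto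
      show "t \<in> C" "\<theta> \<in> C"
        using S t by (auto simp: C_def dist_real_def)
      fix u assume "u \<in> C"
      then have u: "u \<in> S" "\<bar>u - \<theta>\<bar> \<le> \<bar>t - \<theta>\<bar>"
        by (auto simp: C_def dist_real_def)
      have "(e has_field_derivative e1 u) (at u within C)"
        using e[OF u(1)] unfolding has_real_derivative_iff_has_vector_derivative
        by (rule has_vector_derivative_within_subset) (simp add: C_def)
      then show "(g has_field_derivative e1 u - (e1 \<theta> + e2 * (u - \<theta>))) (at u within C)"
        unfolding g_def by (auto intro!: derivative_eq_intros simp: field_simps)
      have "\<bar>e1 u - e1 \<theta> - (u - \<theta>) * e2\<bar> \<le> \<kappa> * \<bar>u - \<theta>\<bar>"
        using u t by (intro r) auto
      also have "\<dots> \<le> \<kappa> * \<bar>t - \<theta>\<bar>"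
        using u \<open>\<kappa> > 0\<close> by simp
      finally show "norm (e1 u - (e1 \<theta> + e2 * (u - \<theta>))) \<le> \<kappa> * \<bar>t - \<theta>\<bar>"
        by (simp add: algebra_simps)
    qed
    then show ?thesis
      by (simp add: g_def power2_eq_square abs_mult algebra_simps)
  qed
  with \<open>r > 0\<close> that show ?thesis
    by blast
qed

lemma Ck_on_2D:
  assumes "Ck_on 2 g \<Omega>" "p \<in> \<Omega>"
  shows "(g has_derivative frechet_derivative g (at p)) (at p)"
    and "(\<lambda>p. frechet_derivative g (at p) h) differentiable (at p)"
    and "continuous_on \<Omega> (\<lambda>p. frechet_derivative (\<lambda>p. frechet_derivative g (at p) h) (at p) k)"
  using assms by (auto simp: numeral_2_eq_2 simp flip: frechet_derivative_works)

lemma Ck_on_continuous_on: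
  assumes "Ck_on (Suc k) g \<Omega>"
  shows "continuous_on \<Omega> g"
  using assms
  by (auto intro!: continuous_at_imp_continuous_on differentiable_imp_continuous_within)

text \<open>The base point \<open>p\<close> will move along the trajectory, while the second-order
  coefficient is frozen at \<open>p0\<close>. Continuity of the second derivative makes the cost of
  freezing at most \<open>\<kappa>\<close>, uniformly in \<open>p\<close>; two applications of the
  mean value inequality along the segment in direction \<open>k\<close> turn this into
  \<open>\<kappa> * \<rho>\<^sup>2\<close>.\<close>

lemma uniform_second_order_remainder:
  fixes g :: "'a::euclidean_space \<Rightarrow> real"
  defines "g1 \<equiv> \<lambda>k p. frechet_derivative g (at p) k"
  defines "g2 \<equiv> \<lambda>k p. frechet_derivative (g1 k) (at p) k"
  assumes g: "Ck_on 2 g \<Omega>" "open \<Omega>" "p0 \<in> \<Omega>" and "\<kappa> > 0"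
  obtains r where "r > 0"
    "\<And>p \<rho>. dist p p0 < r \<Longrightarrow> \<bar>\<rho>\<bar> < r \<Longrightarrow>
       \<bar>g (p + \<rho> *\<^sub>R k) - (g p + \<rho> * g1 k p + \<rho>\<^sup>2 / 2 * g2 k p0)\<bar> \<le> \<kappa> * \<rho>\<^sup>2"
proof -
  have "continuous_on \<Omega> (g2 k)"
    unfolding g1_def g2_def using g(1,3) by (rule Ck_on_2D)
  then have "isCont (g2 k) p0"
    using g continuous_on_eq_continuous_at by blast
  then obtain r1 where r1: "r1 > 0" "\<And>q. dist q p0 < r1 \<Longrightarrow> \<bar>g2 k q - g2 k p0\<bar> \<le> \<kappa>"
    using \<open>\<kappa> > 0\<close> unfolding continuous_at_eps_delta dist_real_def by (meson less_imp_le)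
  obtain r2 where r2: "r2 > 0" "ball p0 r2 \<subseteq> \<Omega>"
    using g by (meson openE)
  \<comment> \<open>Moving \<open>p\<close> by at most \<open>r\<close> and then by
    \<open>\<rho> *\<^sub>R k\<close> with \<open>\<bar>\<rho>\<bar> \<le> r\<close> changes the
    position by at most \<open>r * (1 + norm k)\<close>.\<close>
  define r where "r = min r1 r2 / (1 + norm k)"
  have r: "r > 0" "r * (1 + norm k) = min r1 r2"
    using r1 r2 add_pos_nonneg[OF zero_less_one norm_ge_zero[of k]] by (auto simp: r_def)
  have near: "dist (p + \<rho> *\<^sub>R k) p0 < min r1 r2" if "dist p p0 < r" "\<bar>\<rho>\<bar> \<le> r" for p \<rho>
  proof -
    have "dist (p + \<rho> *\<^sub>R k) p0 \<le> dist p p0 + \<bar>\<rho>\<bar> * norm k"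
      using norm_triangle_ineq[of "p - p0" "\<rho> *\<^sub>R k"] by (simp add: dist_norm algebra_simps)
    also have "\<dots> < r + r * norm k"
      using that by (intro add_less_le_mono mult_right_mono) auto
    also have "\<dots> = min r1 r2"
      using r(2) by (simp add: algebra_simps)
    finally show ?thesis .
  qed
  have "\<bar>g (p + \<rho> *\<^sub>R k) - (g p + \<rho> * g1 k p + \<rho>\<^sup>2 / 2 * g2 k p0)\<bar> \<le> \<kappa> * \<rho>\<^sup>2"
    if p: "dist p p0 < r" and \<rho>: "\<bar>\<rho>\<bar> < r" for p \<rho>
  proof -
    define C where "C = cball (0::real) \<bar>\<rho>\<bar>"
    have C: "convex C" "0 \<in> C" "\<rho> \<in> C" and C_iff: "\<sigma> \<in> C \<longleftrightarrow> \<bar>\<sigma>\<bar> \<le> \<bar>\<rho>\<bar>" for \<sigma>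
      by (auto simp: C_def)
    have der: "((\<lambda>\<sigma>. g (p + \<sigma> *\<^sub>R k)) has_field_derivative g1 k (p + \<sigma> *\<^sub>R k)) (at \<sigma> within C)"
      and der1: "((\<lambda>\<sigma>. g1 k (p + \<sigma> *\<^sub>R k)) has_field_derivative g2 k (p + \<sigma> *\<^sub>R k)) (at \<sigma> within C)"
      and bnd: "\<bar>g2 k (p + \<sigma> *\<^sub>R k) - g2 k p0\<bar> \<le> \<kappa>"
      if "\<sigma> \<in> C" for \<sigma>
    proof -
      have d: "dist (p + \<sigma> *\<^sub>R k) p0 < min r1 r2"
        using p \<rho> that C_iff by (intro near) auto
      then have in\<Omega>: "p + \<sigma> *\<^sub>R k \<in> \<Omega>"
        using r2 by (auto simp: dist_commute)
      have line: "((\<lambda>\<sigma>. p + \<sigma> *\<^sub>R k) has_vector_derivative k) (at \<sigma> within C)"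
        by (auto intro!: derivative_eq_intros)
      show "((\<lambda>\<sigma>. g (p + \<sigma> *\<^sub>R k)) has_field_derivative g1 k (p + \<sigma> *\<^sub>R k)) (at \<sigma> within C)"
        using vector_derivative_diff_chain_within[OF line
            has_derivative_at_withinI[OF Ck_on_2D(1)[OF g(1) in\<Omega>]]]
        by (simp add: has_real_derivative_iff_has_vector_derivative o_def g1_def)
      have "(g1 k has_derivative frechet_derivative (g1 k) (at (p + \<sigma> *\<^sub>R k))) (at (p + \<sigma> *\<^sub>R k))"
        using Ck_on_2D(2)[OF g(1) in\<Omega>] unfolding g1_def by (simp add: frechet_derivative_works)
      then show "((\<lambda>\<sigma>. g1 k (p + \<sigma> *\<^sub>R k)) has_field_derivative g2 k (p + \<sigma> *\<^sub>R k)) (at \<sigma> within C)"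
        using vector_derivative_diff_chain_within[OF line has_derivative_at_withinI]
        by (simp add: has_real_derivative_iff_has_vector_derivative o_def g2_def)
      show "\<bar>g2 k (p + \<sigma> *\<^sub>R k) - g2 k p0\<bar> \<le> \<kappa>"
        using d by (intro r1) auto
    qed
    have first: "\<bar>g1 k (p + \<sigma> *\<^sub>R k) - g1 k p - \<sigma> * g2 k p0\<bar> \<le> \<kappa> * \<bar>\<rho>\<bar>" if "\<sigma> \<in> C" for \<sigma>
    proof -
      define f where "f = (\<lambda>\<sigma>. g1 k (p + \<sigma> *\<^sub>R k) - \<sigma> * g2 k p0)"
      have "norm (f \<sigma> - f 0) \<le> \<kappa> * norm (\<sigma> - 0)"
        unfolding f_def
        by (rule field_differentiable_bound[OF C(1) _ _ that C(2),
              where f' = "\<lambda>\<sigma>. g2 k (p + \<sigma> *\<^sub>R k) - g2 k p0"])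
          (auto intro!: derivative_eq_intros der1 simp: bnd)
      also have "\<dots> \<le> \<kappa> * \<bar>\<rho>\<bar>"
        using \<open>\<kappa> > 0\<close> that C_iff by simp
      finally show ?thesis
        by (simp add: f_def algebra_simps)
    qed
    define f where "f = (\<lambda>\<sigma>. g (p + \<sigma> *\<^sub>R k) - (\<sigma> * g1 k p + \<sigma>\<^sup>2 / 2 * g2 k p0))"
    have "norm (f \<rho> - f 0) \<le> \<kappa> * \<bar>\<rho>\<bar> * norm (\<rho> - 0)"
      unfolding f_def
      by (rule field_differentiable_bound[OF C(1) _ _ C(3,2),
            where f' = "\<lambda>\<sigma>. g1 k (p + \<sigma> *\<^sub>R k) - (g1 k p + \<sigma> * g2 k p0)"])
        (auto intro!: derivative_eq_intros der first simp: diff_diff_eq[symmetric] first)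
    then show ?thesis
      by (simp add: f_def power2_eq_square abs_mult algebra_simps)
  qed
  with r(1) that show ?thesis
    by blast
qed

text \<open>In the first derivative \<open>g' (\<gamma> t) (\<gamma>1 t)\<close> the base point and
  the direction both depend on \<open>t\<close>, whereas \<open>Ck_on\<close> provides
  differentiability in a fixed direction. Expanding the direction in the basis reduces the second
  derivative at \<open>\<theta>\<close> to the product rule.\<close>

lemma compose_path_twice_differentiable:
  fixes g :: "'a::euclidean_space \<Rightarrow> 'b::real_normed_vector" and \<gamma> :: "real \<Rightarrow> 'a"
  assumes g: "Ck_on 2 g \<Omega>"
    and \<gamma>: "\<And>t. t \<in> S \<Longrightarrow> \<gamma> t \<in> \<Omega>"
      "\<And>t. t \<in> S \<Longrightarrow> (\<gamma> has_vector_derivative \<gamma>1 t) (at t within S)"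
      "(\<gamma>1 has_vector_derivative \<gamma>2) (at \<theta> within S)"
    and "\<theta> \<in> S"
  obtains e1 e2 where
    "\<And>t. t \<in> S \<Longrightarrow> ((\<lambda>t. g (\<gamma> t)) has_vector_derivative e1 t) (at t within S)"
    "(e1 has_vector_derivative e2) (at \<theta> within S)"
proof -
  define g' where "g' = (\<lambda>p. frechet_derivative g (at p))"
  define e1 where "e1 = (\<lambda>t. g' (\<gamma> t) (\<gamma>1 t))"
  have g': "(g has_derivative g' p) (at p)" if "p \<in> \<Omega>" for p
    unfolding g'_def using g that by (rule Ck_on_2D)
  have e1_eq: "e1 t = (\<Sum>b\<in>Basis. (\<gamma>1 t \<bullet> b) *\<^sub>R g' (\<gamma> t) b)" if "t \<in> S" for t
  proof -
    have "linear (g' (\<gamma> t))"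
      using g' \<gamma>(1) that has_derivative_linear by blast
    then show ?thesis
      using linear_sum[of "g' (\<gamma> t)" "\<lambda>b. (\<gamma>1 t \<bullet> b) *\<^sub>R b" Basis]
      by (simp add: e1_def linear_cmul euclidean_representation)
  qed
  have "((\<lambda>t. g (\<gamma> t)) has_vector_derivative e1 t) (at t within S)" if "t \<in> S" for t
    using vector_derivative_diff_chain_within[OF \<gamma>(2)[OF that]
        has_derivative_at_withinI[OF g'[OF \<gamma>(1)[OF that]]]]
    by (simp add: o_def e1_def)
  moreover have "(\<lambda>t. \<Sum>b\<in>Basis. (\<gamma>1 t \<bullet> b) *\<^sub>R g' (\<gamma> t) b) differentiable (at \<theta> within S)"
  proof (intro differentiable_sum differentiable_scaleR ballI)
    fix b :: 'a
    show "(\<lambda>t. \<gamma>1 t \<bullet> b) differentiable (at \<theta> within S)"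
      using bounded_linear.has_vector_derivative[OF bounded_linear_inner_left \<gamma>(3)]
      by (rule differentiableI_vector)
    have "(\<lambda>p. g' p b) differentiable (at (\<gamma> \<theta>) within \<gamma> ` S)"
      unfolding g'_def using Ck_on_2D(2)[OF g \<gamma>(1)[OF \<open>\<theta> \<in> S\<close>]] by (rule differentiable_at_withinI)
    then show "(\<lambda>t. g' (\<gamma> t) b) differentiable (at \<theta> within S)"
      using differentiable_chain_within[of \<gamma> \<theta> S "\<lambda>p. g' p b"] \<gamma>(2)[OF \<open>\<theta> \<in> S\<close>]
      by (auto simp: o_def intro: differentiableI_vector)
  qed simp
  then have "e1 differentiable (at \<theta> within S)"
    using e1_eq \<open>\<theta> \<in> S\<close>
    by (metis (no_types, lifting) differentiable_def has_derivative_transform)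
  ultimately show ?thesis
    using that vector_derivative_works by blast
qed

subsection \<open>Piecewise differentiable functions\<close>

text \<open>A variant of \<open>KC1\<close> with an explicit derivative \<open>v\<close>. One-sided
  limits are demanded at every interior point, not only on \<open>S\<close>: in a sum, a corner of
  one summand is in general no corner of the other, and the limits of both are needed there.\<close>

definition has_piecewise_derivative ::
  "(real \<Rightarrow> 'a::real_normed_vector) \<Rightarrow> (real \<Rightarrow> 'a) \<Rightarrow> real set \<Rightarrow> real \<Rightarrow> real \<Rightarrow> bool" where
  "has_piecewise_derivative x v S t0 t1 \<longleftrightarrow>
     finite S \<and> S \<subseteq> {t0<..<t1} \<and> continuous_on {t0..t1} x \<and>
     (\<forall>t\<in>{t0..t1} - S. (x has_vector_derivative v t) (at t within {t0..t1})) \<and>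
     continuous_on ({t0..t1} - S) v \<and>
     (\<forall>s\<in>{t0<..<t1}. (\<exists>l. (v \<longlongrightarrow> l) (at_left s)) \<and> (\<exists>r. (v \<longlongrightarrow> r) (at_right s)))"

lemma at_within_diff_finite:
  fixes t :: "'a::t1_space"
  assumes "finite S" "t \<notin> S"
  shows "at t within (A - S) = at t within A"
proof (rule at_within_nhd[where S = "- S"])
  show "open (- S)"
    using assms by (simp add: finite_imp_closed open_Compl)
qed (use assms in auto)

lemma eventually_at_within_in_open:
  assumes "open U" "x \<in> U"
  shows "\<forall>\<^sub>F y in at x within T. y \<in> U"
  using assms by (auto simp: eventually_at_topological)

lemma eventually_notin_finite:
  fixes t :: "'a::t1_space"
  assumes "finite S"
  shows "\<forall>\<^sub>F s in at t within A. s \<notin> S"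
proof -
  have "open (- (S - {t}))"
    using assms by (intro open_Compl finite_imp_closed finite_Diff)
  then have "\<forall>\<^sub>F s in at t within A. s \<in> - (S - {t})"
    by (rule eventually_at_within_in_open) simp
  moreover have "\<forall>\<^sub>F s in at t within A. s \<noteq> t"
    by (auto simp: eventually_at_filter)
  ultimately show ?thesis
    by eventually_elim auto
qed

lemma eventually_in_Icc:
  fixes s :: real
  assumes "s \<in> {t0<..<t1}"
  shows "\<forall>\<^sub>F t in at s. t \<in> {t0..t1}"
proof -
  have "\<forall>\<^sub>F t in at s. t \<in> {t0<..<t1}"
    using assms by (intro eventually_at_in_open') auto
  then show ?thesis
    by eventually_elim auto
qed

lemma eventually_at_leftI':
  "eventually P (at s) \<Longrightarrow> eventually P (at_left (s::real))"
  and eventually_at_rightI':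
  "eventually P (at s) \<Longrightarrow> eventually P (at_right (s::real))"
  by (auto simp: eventually_at_split)

lemma has_piecewise_derivative_ddt:
  assumes "has_piecewise_derivative x v S t0 t1" "t0 < t1" "t \<in> {t0..t1} - S"
  shows "ddt {t0..t1} x t = v t"
proof -
  have "(x has_vector_derivative v t) (at t within {t0..t1})"
    using assms by (auto simp: has_piecewise_derivative_def)
  then show ?thesis
    unfolding ddt_def using assms
    by (intro vector_derivative_within) (auto simp: trivial_limit_within islimpt_Icc)
qed

lemma has_piecewise_derivative_imp_KC1:
  fixes x :: "real \<Rightarrow> 'a::real_normed_vector"
  assumes x: "has_piecewise_derivative x v S t0 t1" and "t0 < t1"
  shows "KC1 t0 t1 x"
proof -
  have S: "finite S" "S \<subseteq> {t0<..<t1}"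
    using x by (auto simp: has_piecewise_derivative_def)
  have eq: "ddt {t0..t1} x t = v t" if "t \<in> {t0..t1} - S" for t
    using assms that by (rule has_piecewise_derivative_ddt)
  have ev: "\<forall>\<^sub>F t in at s. v t = ddt {t0..t1} x t" if "s \<in> S" for s
    using eventually_in_Icc[of s t0 t1] eventually_notin_finite[OF S(1), of s UNIV] S(2) that
    by (auto elim!: eventually_elim2 simp: eq)
  show ?thesis
    unfolding KC1_def
  proof (intro conjI exI[of _ S] ballI)
    show "continuous_on ({t0..t1} - S) (ddt {t0..t1} x)"
      using x by (subst continuous_on_cong[OF refl eq]) (auto simp: has_piecewise_derivative_def)
    fix s assume s: "s \<in> S"
    then obtain l r where lr: "(v \<longlongrightarrow> l) (at_left s)" "(v \<longlongrightarrow> r) (at_right s)"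
      using x S by (fastforce simp: has_piecewise_derivative_def)
    show "\<exists>l. (ddt {t0..t1} x \<longlongrightarrow> l) (at_left s)"
      using Lim_transform_eventually[OF lr(1) eventually_at_leftI'[OF ev[OF s]]] by blast
    show "\<exists>r. (ddt {t0..t1} x \<longlongrightarrow> r) (at_right s)"
      using Lim_transform_eventually[OF lr(2) eventually_at_rightI'[OF ev[OF s]]] by blast
  qed (use x in \<open>auto simp: has_piecewise_derivative_def intro: differentiableI_vector\<close>)
qed

text \<open>At the interior points outside the angular set the one-sided limits come from continuity
  of the derivative.\<close>

lemma KC1_imp_has_piecewise_derivative:
  fixes x :: "real \<Rightarrow> 'a::real_normed_vector"
  assumes "KC1 t0 t1 x"
  obtains S where "has_piecewise_derivative x (ddt {t0..t1} x) S t0 t1"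
proof -
  let ?v = "ddt {t0..t1} x"
  obtain S where S: "finite S" "S \<subseteq> {t0<..<t1}"
    and x: "continuous_on {t0..t1} x" "\<And>t. t \<in> {t0..t1} - S \<Longrightarrow> x differentiable (at t within {t0..t1})"
      "continuous_on ({t0..t1} - S) ?v"
    and lim: "\<And>s. s \<in> S \<Longrightarrow> (\<exists>l. (?v \<longlongrightarrow> l) (at_left s)) \<and> (\<exists>r. (?v \<longlongrightarrow> r) (at_right s))"
    using assms unfolding KC1_def by blast
  have "(\<exists>l. (?v \<longlongrightarrow> l) (at_left s)) \<and> (\<exists>r. (?v \<longlongrightarrow> r) (at_right s))" if s: "s \<in> {t0<..<t1}" for s
  proof (cases "s \<in> S")
    case False
    have "open ({t0<..<t1} - S)"
      using S by (simp add: finite_imp_closed open_Diff)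
    moreover have "continuous_on ({t0<..<t1} - S) ?v"
      using x(3) by (rule continuous_on_subset) auto
    ultimately have "isCont ?v s"
      using s False by (simp add: continuous_on_eq_continuous_at)
    then show ?thesis
      by (auto simp: isCont_def filterlim_at_split)
  qed (use lim in blast)
  moreover have "(x has_vector_derivative ?v t) (at t within {t0..t1})" if "t \<in> {t0..t1} - S" for t
    using x(2)[OF that] by (simp add: ddt_def vector_derivative_works)
  ultimately have "has_piecewise_derivative x ?v S t0 t1"
    using S x unfolding has_piecewise_derivative_def by blast
  then show ?thesis
    by (rule that)
qed

lemma has_piecewise_derivative_add:
  assumes "has_piecewise_derivative x v S t0 t1" "has_piecewise_derivative y w R t0 t1"
  shows "has_piecewise_derivative (\<lambda>t. x t + y t) (\<lambda>t. v t + w t) (S \<union> R) t0 t1"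
  unfolding has_piecewise_derivative_def
proof (intro conjI ballI)
  show "continuous_on ({t0..t1} - (S \<union> R)) (\<lambda>t. v t + w t)"
    using assms unfolding has_piecewise_derivative_def
    by (intro continuous_on_add) (auto elim!: continuous_on_subset)
  fix s assume s: "s \<in> {t0<..<t1}"
  obtain l l' where "(v \<longlongrightarrow> l) (at_left s)" "(w \<longlongrightarrow> l') (at_left s)"
    using assms s unfolding has_piecewise_derivative_def by blast
  then show "\<exists>l. ((\<lambda>t. v t + w t) \<longlongrightarrow> l) (at_left s)"
    by (intro exI) (rule tendsto_add)
  obtain r r' where "(v \<longlongrightarrow> r) (at_right s)" "(w \<longlongrightarrow> r') (at_right s)"
    using assms s unfolding has_piecewise_derivative_def by blast
  then show "\<exists>r. ((\<lambda>t. v t + w t) \<longlongrightarrow> r) (at_right s)"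
    by (intro exI) (rule tendsto_add)
qed (use assms in \<open>auto simp: has_piecewise_derivative_def
       intro: continuous_on_add has_vector_derivative_add\<close>)

text \<open>\<open>v\<close> may jump, so compactness is applied to local boundedness: one-sided
  limits give it on \<open>S\<close>, continuity elsewhere, and a finite subcover makes it
  global.\<close>

lemma has_piecewise_derivative_bounded:
  fixes v :: "real \<Rightarrow> 'a::real_normed_vector"
  assumes x: "has_piecewise_derivative x v S t0 t1"
  shows "bounded (v ` {t0..t1})"
proof -
  have loc: "\<exists>B U. open U \<and> t \<in> U \<and> (\<forall>s\<in>U \<inter> {t0..t1}. norm (v s) \<le> B)" if t: "t \<in> {t0..t1}" for t
  proof -
    have bd: "\<exists>B. \<forall>\<^sub>F s in F. norm (v s) \<le> B" if "(v \<longlongrightarrow> l) F" for l F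
      using order_tendstoD(2)[OF tendsto_norm[OF that], of "norm l + 1"]
      by (auto intro!: exI[of _ "norm l + 1"] elim: eventually_mono)
    have "\<exists>B. \<forall>\<^sub>F s in at t within {t0..t1}. norm (v s) \<le> B"
    proof (cases "t \<in> S")
      case True
      then have "t \<in> {t0<..<t1}"
        using x by (auto simp: has_piecewise_derivative_def)
      then obtain B1 B2 where "\<forall>\<^sub>F s in at_left t. norm (v s) \<le> B1"
        "\<forall>\<^sub>F s in at_right t. norm (v s) \<le> B2"
        using x bd unfolding has_piecewise_derivative_def by meson
      then have "\<forall>\<^sub>F s in at t. norm (v s) \<le> max B1 B2"
        unfolding eventually_at_split by (auto elim: eventually_mono)
      then show ?thesis
        using filter_leD[OF at_le[OF subset_UNIV]] by blast
    next
      case False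
      then have "(v \<longlongrightarrow> v t) (at t within ({t0..t1} - S))"
        using x t unfolding has_piecewise_derivative_def continuous_on_def by blast
      then have "(v \<longlongrightarrow> v t) (at t within {t0..t1})"
        using x False at_within_diff_finite[of S t "{t0..t1}"]
        by (simp add: has_piecewise_derivative_def)
      then show ?thesis
        by (rule bd)
    qed
    then obtain B U where "open U" "t \<in> U" "\<forall>s\<in>U. s \<noteq> t \<longrightarrow> s \<in> {t0..t1} \<longrightarrow> norm (v s) \<le> B"
      unfolding eventually_at_topological by blast
    \<comment> \<open>The filter at \<open>t\<close> ignores the value \<open>v t\<close>, which may
      be arbitrary on \<open>S\<close>; the maximum puts it back.\<close>
    then show ?thesis
      by (intro exI[of _ "max B (norm (v t))"] exI[of _ U]) fastforce
  qed
  then obtain B U where U: "\<And>t. t \<in> {t0..t1} \<Longrightarrow> open (U t) \<and> t \<in> U t \<and>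
      (\<forall>s\<in>U t \<inter> {t0..t1}. norm (v s) \<le> B t)"
    by metis
  obtain C where C: "C \<subseteq> {t0..t1}" "finite C" "{t0..t1} \<subseteq> (\<Union>t\<in>C. U t)"
    by (rule compactE_image[of "{t0..t1}" "{t0..t1}" U]) (use U in auto)
  have "bounded (v ` (U t \<inter> {t0..t1}))" if "t \<in> C" for t
    unfolding bounded_iff using U[of t] C(1) that by blast
  then have "bounded (\<Union>t\<in>C. v ` (U t \<inter> {t0..t1}))"
    using C(2) by (simp add: bounded_UN)
  then show ?thesis
    by (rule bounded_subset) (use C(3) in blast)
qed

section \<open>Measurability and integrability along piecewise differentiable functions\<close>

lemma borel_measurable_continuous_off_finite:
  fixes g :: "real \<Rightarrow> 'b::euclidean_space"
  assumes "finite S" "continuous_on ({t0..t1} - S) g"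
  shows "g \<in> borel_measurable (lebesgue_on {t0..t1})"
proof (rule measurable_restrict_countable[of "S \<inter> {t0..t1}"])
  have S: "S \<inter> T \<in> sets lebesgue" for T
    using assms(1) by (simp add: negligible_finite negligible_imp_sets)
  from S[of UNIV] have "g \<in> borel_measurable (lebesgue_on ({t0..t1} - S))"
    using assms(2) by (intro continuous_imp_measurable_on_sets_lebesgue) auto
  then show "g \<in> borel_measurable (restrict_space (lebesgue_on {t0..t1}) (- (S \<inter> {t0..t1})))"
    using S[of "{t0..t1}"] Compl_in_sets_lebesgue[of "S \<inter> {t0..t1}"]
    by (subst restrict_restrict_space) (auto simp: Diff_eq Int_Un_distrib)
  show "{s} \<in> sets (lebesgue_on {t0..t1})" if "s \<in> S \<inter> {t0..t1}" for s
    using that by (simp add: sets_restrict_space_iff)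
qed (use assms in \<open>auto simp: countable_finite\<close>)

text \<open>The integrand may jump with the velocity, so integrability comes from measurability
  together with a bound, namely that of \<open>L\<close> on a compact product containing all the
  arguments.\<close>

lemma lagrangian_integrable:
  fixes L :: "'n::finite lagrangian"
  assumes x: "has_piecewise_derivative x v S t0 t1" and "t0 < t1" "{t0..t1} \<subseteq> A"
    and L: "continuous_on (A \<times> UNIV \<times> UNIV) (\<lambda>(t, x, v). L t x v)"
  shows "(\<lambda>t. L t (x t) (ddt {t0..t1} x t)) integrable_on {t0..t1}"
proof -
  have L': "continuous_on T (\<lambda>t. L t (y t) (w t))"
    if "continuous_on T y" "continuous_on T w" "T \<subseteq> {t0..t1}" for T y w
  proof -
    have "continuous_on T (\<lambda>t. (t, y t, w t))"
      using that by (intro continuous_intros)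
    from continuous_on_compose2[OF L this] show ?thesis
      using that assms(3) by auto
  qed
  have S: "finite S" "S \<subseteq> {t0<..<t1}" and x_cont: "continuous_on {t0..t1} x"
    and v_cont: "continuous_on ({t0..t1} - S) v"
    using x by (auto simp: has_piecewise_derivative_def)
  have meas: "(\<lambda>t. L t (x t) (v t)) \<in> borel_measurable (lebesgue_on {t0..t1})"
    using S(1) by (rule borel_measurable_continuous_off_finite)
      (auto intro!: L' v_cont intro: continuous_on_subset[OF x_cont])
  obtain Bx Bv where B: "\<And>t. t \<in> {t0..t1} \<Longrightarrow> norm (x t) \<le> Bx" "\<And>t. t \<in> {t0..t1} \<Longrightarrow> norm (v t) \<le> Bv"
    using compact_imp_bounded[OF compact_continuous_image[OF x_cont compact_Icc]]
      has_piecewise_derivative_bounded[OF x]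
    unfolding bounded_iff by (metis imageI)
  let ?K = "{t0..t1} \<times> cball (0::real^'n) Bx \<times> cball (0::real^'n) Bv"
  have "compact ((\<lambda>(t, x, v). L t x v) ` ?K)"
    using assms(3)
    by (intro compact_continuous_image continuous_on_subset[OF L] compact_Times compact_Icc compact_cball) auto
  then obtain M where M: "\<And>p. p \<in> ?K \<Longrightarrow> \<bar>(\<lambda>(t, x, v). L t x v) p\<bar> \<le> M"
    using compact_imp_bounded by (force simp: bounded_iff)
  have "(\<lambda>t. L t (x t) (v t)) integrable_on {t0..t1}"
  proof (rule measurable_bounded_by_integrable_imp_integrable_real[OF meas, where g = "\<lambda>_. M"])
    fix t assume "t \<in> {t0..t1}"
    then show "\<bar>L t (x t) (v t)\<bar> \<le> M"
      using M[of "(t, x t, v t)"] B by auto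
  qed auto
  \<comment> \<open>On the finite set \<open>S\<close> nothing is known about \<open>ddt\<close>;
    elsewhere it agrees with \<open>v\<close>.\<close>
  then show ?thesis
    by (rule integrable_spike_finite[OF S(1), rotated])
      (use has_piecewise_derivative_ddt[OF x \<open>t0 < t1\<close>] in auto)
qed

text \<open>A building block with a single corner. The hat is a sum of three multiples of such
  functions, so the derivative and its behavior at a corner are treated once.\<close>

definition hinge :: "real \<Rightarrow> real \<Rightarrow> real" where
  "hinge c t = max 0 (t - c)"

text \<open>The clause \<open>c \<le> t0\<close> matters for \<open>t = c = t0\<close> only: there the derivative within the interval is
  the right-hand one.\<close>

lemma has_piecewise_derivative_hinge:
  fixes k :: "'a::real_normed_vector"
  assumes "t0 < t1"
  shows "has_piecewise_derivative (\<lambda>t. hinge c t *\<^sub>R k)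
    (\<lambda>t. if c < t \<or> c \<le> t0 then k else 0) ({c} \<inter> {t0<..<t1}) t0 t1"
  unfolding has_piecewise_derivative_def
proof (intro conjI ballI)
  let ?\<sigma> = "\<lambda>t. if c < t \<or> c \<le> t0 then k else 0"
  show "continuous_on {t0..t1} (\<lambda>t. hinge c t *\<^sub>R k)"
    unfolding hinge_def by (intro continuous_intros)
  have up: "\<forall>\<^sub>F t in at s within T. ?\<sigma> t = k" if "c < s \<or> c \<le> t0" for s T
  proof -
    have "\<forall>\<^sub>F t in at s within T. c < t" if "c < s"
      using eventually_at_within_in_open[of "{c<..}" s T] that by simp
    then show ?thesis
      using that by (cases "c \<le> t0") (simp, simp add: eventually_mono)
  qed
  have down: "\<forall>\<^sub>F t in at s within T. ?\<sigma> t = 0" if "s < c" "t0 < c" for s T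
  proof -
    have "\<forall>\<^sub>F t in at s within T. t < c"
      using eventually_at_within_in_open[of "{..<c}" s T] that by simp
    then show ?thesis
      by eventually_elim (use that in auto)
  qed
  show "continuous_on ({t0..t1} - ({c} \<inter> {t0<..<t1})) ?\<sigma>"
    unfolding continuous_on_def
  proof
    fix t assume t: "t \<in> {t0..t1} - ({c} \<inter> {t0<..<t1})"
    \<comment> \<open>The last alternative is a corner at the right end of the interval: there the
      function vanishes on the whole interval and the formula gives slope 0 at \<open>t1\<close>, as
      the derivative within the interval requires.\<close>
    have "(c < t \<or> c \<le> t0) \<or> (t < c \<and> t0 < c) \<or> (t = t1 \<and> c = t1)"
      using t by auto
    then consider "c < t \<or> c \<le> t0" | "t < c" "t0 < c" | "t = t1" "c = t1"
      by blast
    then have "\<forall>\<^sub>F s in at t within ({t0..t1} - ({c} \<inter> {t0<..<t1})). ?\<sigma> s = ?\<sigma> t"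
    proof cases
      case 3
      then show ?thesis
        using \<open>t0 < t1\<close> by (auto simp: eventually_at_filter)
    next
      case 1
      then show ?thesis
        using up[OF 1] by simp
    next
      case 2
      then show ?thesis
        using down[OF 2] by simp
    qed
    then show "(?\<sigma> \<longlongrightarrow> ?\<sigma> t) (at t within ({t0..t1} - ({c} \<inter> {t0<..<t1})))"
      by (rule tendsto_eventually)
  qed
  fix s
  show "\<exists>l. (?\<sigma> \<longlongrightarrow> l) (at_left s)"
  proof (cases "c < s \<or> c \<le> t0")
    case False
    then have "\<forall>\<^sub>F t in at_left s. ?\<sigma> t = 0"
      by (auto simp: eventually_at_filter)
    then show ?thesis
      by (intro exI) (rule tendsto_eventually)
  qed (rule exI, rule tendsto_eventually, rule up)
  show "\<exists>r. (?\<sigma> \<longlongrightarrow> r) (at_right s)"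
  proof (cases "s < c \<and> t0 < c")
    case False
    then have "\<forall>\<^sub>F t in at_right s. ?\<sigma> t = k"
      by (auto simp: eventually_at_filter)
    then show ?thesis
      by (intro exI) (rule tendsto_eventually)
  qed (rule exI, rule tendsto_eventually, rule down, auto)
next
  fix t assume t: "t \<in> {t0..t1} - ({c} \<inter> {t0<..<t1})"
  have aff: "((\<lambda>t. (t - c) *\<^sub>R k) has_vector_derivative k) (at t within {t0..t1})"
    by (auto intro!: derivative_eq_intros)
  have "c < t \<or> c \<le> t0 \<or> (t < c \<and> t0 < c) \<or> (t = t1 \<and> c = t1)"
    using t by auto
  then consider "c < t" | "c \<le> t0" | "t < c" "t0 < c" | "t = t1" "c = t1"
    by blast
  then show "((\<lambda>t. hinge c t *\<^sub>R k) has_vector_derivative (if c < t \<or> c \<le> t0 then k else 0))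
      (at t within {t0..t1})"
  proof cases
    case 1
    then show ?thesis
      using t by (auto simp: hinge_def dist_real_def
        intro!: has_vector_derivative_transform_within[OF aff, of "t - c"])
  next
    case 2
    then show ?thesis
      using t by (auto simp: hinge_def intro!: has_vector_derivative_transform_within[OF aff, of 1])
  next
    case 3
    then show ?thesis
      using t by (auto simp: hinge_def dist_real_def
        intro!: has_vector_derivative_transform_within[OF has_vector_derivative_const, of "c - t"])
  next
    case 4
    then show ?thesis
      using t \<open>t0 < t1\<close> by (auto simp: hinge_def
        intro!: has_vector_derivative_transform_within[OF has_vector_derivative_const, of 1])
  qed
qed auto

subsection \<open>Hat variations of a weak local minimum\<close>

text \<open>The linear relation between \<open>a\<close> and \<open>b\<close> brings the hat back to
  zero at \<open>z\<close>, and \<open>z - u \<le> 1\<close> bounds its height by the same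
  \<open>\<delta>\<close> as its slopes. The competitor differs from \<open>xb\<close> only between
  \<open>u\<close> and \<open>z\<close>, so the remaining parts of the two integrals cancel. The
  exceptional set \<open>N\<close> allows \<open>v\<close> to carry a one-sided limit in place of
  the derivative.\<close>

lemma weak_local_min_hat_variation:
  fixes L :: "'n::finite lagrangian" and xb v :: "real \<Rightarrow> real^'n"
  assumes "t0 < t1" "{t0..t1} \<subseteq> A"
    and L: "continuous_on (A \<times> UNIV \<times> UNIV) (\<lambda>(t, x, v). L t x v)"
    and adm: "admissible t0 t1 x0 x1 xb"
    and min: "\<And>x. admissible t0 t1 x0 x1 x \<Longrightarrow>
        max (C_norm t0 t1 (\<lambda>t. x t - xb t))
            (Linf_norm t0 t1 (\<lambda>t. ddt {t0..t1} x t - ddt {t0..t1} xb t)) \<le> ereal \<delta> \<Longrightarrow>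
        J L t0 t1 x \<ge> J L t0 t1 xb"
    and uwz: "t0 \<le> u" "u < w" "w < z" "z \<le> t1" "z - u \<le> 1"
    and ab: "(w - u) *\<^sub>R a + (z - w) *\<^sub>R b = 0" "norm a \<le> \<delta>" "norm b \<le> \<delta>"
    and N: "finite N" "\<And>t. t \<in> {u..z} - N \<Longrightarrow> ddt {t0..t1} xb t = v t"
  shows "integral {u..w} (\<lambda>t. L t (xb t) (v t)) + integral {w..z} (\<lambda>t. L t (xb t) (v t))
    \<le> integral {u..w} (\<lambda>t. L t (xb t + (t - u) *\<^sub>R a) (v t + a)) +
      integral {w..z} (\<lambda>t. L t (xb t + (t - z) *\<^sub>R b) (v t + b))"
proof -
  define vb where "vb = ddt {t0..t1} xb"
  \<comment> \<open>The coefficients are the jumps of the slope: from 0 to \<open>a\<close>, from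
    \<open>a\<close> to \<open>b\<close>, from \<open>b\<close> to 0.\<close>
  define h where "h = (\<lambda>t. hinge u t *\<^sub>R a + hinge w t *\<^sub>R (b - a) + hinge z t *\<^sub>R (- b))"
  define x where "x = (\<lambda>t. xb t + h t)"
  have h_ivl: "h t = 0" if "t \<le> u \<or> z \<le> t" for t
  proof (cases "t \<le> u")
    case False
    then have "h t = (w - u) *\<^sub>R a + (z - w) *\<^sub>R b"
      using uwz that by (simp add: h_def hinge_def algebra_simps)
    with ab(1) show ?thesis
      by simp
  qed (use uwz in \<open>simp add: h_def hinge_def\<close>)
  have h_a: "h t = (t - u) *\<^sub>R a" if "u \<le> t" "t \<le> w" for t
    using uwz that by (simp add: h_def hinge_def)
  have h_b: "h t = (t - z) *\<^sub>R b" if "w \<le> t" "t \<le> z" for t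
  proof -
    have "h t = (t - z) *\<^sub>R b + ((w - u) *\<^sub>R a + (z - w) *\<^sub>R b)"
      using uwz that by (simp add: h_def hinge_def algebra_simps)
    with ab(1) show ?thesis
      by simp
  qed
  have "\<delta> \<ge> 0"
    using ab(2) norm_ge_zero by (rule order_trans[rotated])
  have h_le: "norm (h t) \<le> \<delta>" for t
  proof -
    consider "t \<le> u \<or> z \<le> t" | "u \<le> t" "t \<le> w" | "w \<le> t" "t \<le> z"
      by linarith
    then show ?thesis
    proof cases
      case 2
      have "\<bar>t - u\<bar> * norm a \<le> 1 * \<delta>"
        using 2 uwz ab by (intro mult_mono) auto
      then show ?thesis
        using h_a[OF 2] by simp
    next
      case 3
      have "\<bar>t - z\<bar> * norm b \<le> 1 * \<delta>"
        using 3 uwz ab by (intro mult_mono) auto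
      then show ?thesis
        using h_b[OF 3] by simp
    qed (use h_ivl \<open>\<delta> \<ge> 0\<close> in simp)
  qed

  obtain S where xb: "has_piecewise_derivative xb vb S t0 t1"
    using adm unfolding admissible_def vb_def by (blast elim: KC1_imp_has_piecewise_derivative)
  define s where "s = (\<lambda>c (k::real^'n) t. if c < t \<or> c \<le> t0 then k else 0)"
  define S' where "S' = S \<union> (({u} \<inter> {t0<..<t1} \<union> {w} \<inter> {t0<..<t1}) \<union> {z} \<inter> {t0<..<t1})"
  define h' where "h' = (\<lambda>t. s u a t + s w (b - a) t + s z (- b) t)"
  have x: "has_piecewise_derivative x (\<lambda>t. vb t + h' t) S' t0 t1"
    unfolding x_def h_def h'_def s_def S'_def
    by (intro has_piecewise_derivative_add xb has_piecewise_derivative_hinge \<open>t0 < t1\<close>)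
  have ddt_x: "ddt {t0..t1} x t = vb t + h' t" if "t \<in> {t0..t1} - S'" for t
    using has_piecewise_derivative_ddt[OF x \<open>t0 < t1\<close> that] .
  \<comment> \<open>Besides the angular points, the ends and corners are discarded, so that strict
    inequalities decide which slope applies; a finite set affects neither the integrals nor the
    essential supremum.\<close>
  define N' where "N' = N \<union> S' \<union> {t0, t1, u, w, z}"
  have "finite N'"
    using N(1) x by (auto simp: N'_def has_piecewise_derivative_def)
  have h'_0: "h' t = 0" if "t \<in> {t0..t1} - N'" "t < u \<or> z < t" for t
    using that uwz by (auto simp: h'_def s_def)
  have h'_a: "h' t = a" if "t \<in> {u..w} - N'" for t
    using that uwz by (auto simp: h'_def s_def N'_def)
  have h'_b: "h' t = b" if "t \<in> {w..z} - N'" for t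
    using that uwz by (auto simp: h'_def s_def N'_def)

  have adm_x: "admissible t0 t1 x0 x1 x"
    using adm h_ivl uwz has_piecewise_derivative_imp_KC1[OF x \<open>t0 < t1\<close>]
    by (simp add: admissible_def x_def)
  have "C_norm t0 t1 (\<lambda>t. x t - xb t) \<le> ereal \<delta>"
    unfolding C_norm_def by (rule SUP_least) (simp add: x_def h_le)
  moreover have "Linf_norm t0 t1 (\<lambda>t. ddt {t0..t1} x t - vb t) \<le> ereal \<delta>"
    unfolding Linf_norm_def
  proof (rule esssup_I)
    have "continuous_on ({t0..t1} - (S \<union> S')) (\<lambda>t. (vb t + h' t) - vb t)"
      using x xb unfolding has_piecewise_derivative_def
      by (intro continuous_on_diff) (auto intro: continuous_on_subset)
    then have "continuous_on ({t0..t1} - (S \<union> S')) (\<lambda>t. ddt {t0..t1} x t - vb t)"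
      using ddt_x by (subst continuous_on_cong[OF refl]) auto
    then have "(\<lambda>t. ddt {t0..t1} x t - vb t) \<in> borel_measurable (lebesgue_on {t0..t1})"
      using x xb by (intro borel_measurable_continuous_off_finite[of "S \<union> S'"])
        (auto simp: has_piecewise_derivative_def)
    then show "(\<lambda>t. ereal (norm (ddt {t0..t1} x t - vb t))) \<in> borel_measurable (lebesgue_on {t0..t1})"
      by measurable
    have off: "AE t in lebesgue_on {t0..t1}. t \<notin> N'"
    proof (rule AE_I'[of "N' \<inter> {t0..t1}"])
      have "negligible (N' \<inter> {t0..t1})"
        using \<open>finite N'\<close> by (intro negligible_finite) auto
      then show "N' \<inter> {t0..t1} \<in> null_sets (lebesgue_on {t0..t1})"
        by (simp add: null_sets_restrict_space negligible_iff_null_sets)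
    qed auto
    have bound: "ereal (norm (ddt {t0..t1} x t - vb t)) \<le> ereal \<delta>"
      if t: "t \<in> {t0..t1}" "t \<notin> N'" for t
    proof -
      have "t < u \<or> z < t \<or> t \<in> {u..w} \<or> t \<in> {w..z}"
        by auto
      then have "norm (h' t) \<le> \<delta>"
        using h'_0[of t] h'_a[of t] h'_b[of t] t ab \<open>\<delta> \<ge> 0\<close> by auto
      then show ?thesis
        using ddt_x[of t] t by (simp add: N'_def)
    qed
    show "AE t in lebesgue_on {t0..t1}. ereal (norm (ddt {t0..t1} x t - vb t)) \<le> ereal \<delta>"
      by (rule AE_mp[OF off AE_I2]) (use bound in simp)
  qed
  ultimately have "J L t0 t1 xb \<le> J L t0 t1 x"
    by (intro min adm_x) (simp add: vb_def)
  moreover have split: "J L t0 t1 y = integral {t0..u} (\<lambda>t. L t (y t) (ddt {t0..t1} y t)) +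
      integral {u..w} (\<lambda>t. L t (y t) (ddt {t0..t1} y t)) +
      integral {w..z} (\<lambda>t. L t (y t) (ddt {t0..t1} y t)) +
      integral {z..t1} (\<lambda>t. L t (y t) (ddt {t0..t1} y t))"
    if y: "has_piecewise_derivative y y' R t0 t1" for y y' R
  proof -
    let ?F = "\<lambda>t. L t (y t) (ddt {t0..t1} y t)"
    have int: "?F integrable_on {t0..t1}"
      using y \<open>t0 < t1\<close> \<open>{t0..t1} \<subseteq> A\<close> L by (rule lagrangian_integrable)
    have "integral {t0..t1} ?F = integral {t0..u} ?F + integral {u..t1} ?F"
      using int uwz by (intro Henstock_Kurzweil_Integration.integral_combine[symmetric]) auto
    moreover have int1: "?F integrable_on {u..t1}"
      using integrable_on_subinterval[OF int] uwz by auto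
    then have "integral {u..t1} ?F = integral {u..w} ?F + integral {w..t1} ?F"
      using uwz by (intro Henstock_Kurzweil_Integration.integral_combine[symmetric]) auto
    moreover have "?F integrable_on {w..t1}"
      using integrable_on_subinterval[OF int] uwz by auto
    then have "integral {w..t1} ?F = integral {w..z} ?F + integral {z..t1} ?F"
      using uwz by (intro Henstock_Kurzweil_Integration.integral_combine[symmetric]) auto
    ultimately show ?thesis
      by (simp add: J_def)
  qed
  have spike: "integral T f = integral T g"
    if "\<And>t. t \<in> T - N' \<Longrightarrow> f t = g t" for T and f g :: "real \<Rightarrow> real"
    using negligible_finite[OF \<open>finite N'\<close>] that
    by (intro Henstock_Kurzweil_Integration.integral_spike[of N']) auto
  have ddt_x': "ddt {t0..t1} x t = vb t + h' t" if "t \<in> {t0..t1} - N'" for t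
    using ddt_x that by (auto simp: N'_def)
  have in_N': "t0 \<in> N'" "t1 \<in> N'" "u \<in> N'" "w \<in> N'" "z \<in> N'"
    by (auto simp: N'_def)
  have vb_eq: "vb t = v t" if "t \<in> {u..z} - N'" for t
    using N(2)[of t] that by (simp add: vb_def N'_def)
  have x_a: "x t = xb t + (t - u) *\<^sub>R a" if "u \<le> t" "t \<le> w" for t
    using h_a[OF that] by (simp add: x_def)
  have x_b: "x t = xb t + (t - z) *\<^sub>R b" if "w \<le> t" "t \<le> z" for t
    using h_b[OF that] by (simp add: x_def)
  have outer: "L t (x t) (ddt {t0..t1} x t) = L t (xb t) (ddt {t0..t1} xb t)"
    if "t \<in> {t0..u} \<union> {z..t1} - N'" for t
  proof -
    have "t \<in> {t0..t1} - N'" "t < u \<or> z < t"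
      using that uwz in_N' by (cases "t = u"; cases "t = z"; simp; linarith)+
    then show ?thesis
      using ddt_x'[of t] h'_0[of t] h_ivl[of t] by (auto simp: x_def vb_def)
  qed
  have "integral {t0..u} (\<lambda>t. L t (x t) (ddt {t0..t1} x t)) =
      integral {t0..u} (\<lambda>t. L t (xb t) (ddt {t0..t1} xb t))"
    by (intro spike outer) auto
  moreover have "integral {z..t1} (\<lambda>t. L t (x t) (ddt {t0..t1} x t)) =
      integral {z..t1} (\<lambda>t. L t (xb t) (ddt {t0..t1} xb t))"
    by (intro spike outer) auto
  moreover have "integral {u..w} (\<lambda>t. L t (x t) (ddt {t0..t1} x t)) =
      integral {u..w} (\<lambda>t. L t (xb t + (t - u) *\<^sub>R a) (v t + a))"
    using uwz by (intro spike) (simp add: ddt_x' h'_a x_a vb_eq)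
  moreover have "integral {w..z} (\<lambda>t. L t (x t) (ddt {t0..t1} x t)) =
      integral {w..z} (\<lambda>t. L t (xb t + (t - z) *\<^sub>R b) (v t + b))"
    using uwz by (intro spike) (simp add: ddt_x' h'_b x_b vb_eq)
  moreover have "integral {u..w} (\<lambda>t. L t (xb t) (ddt {t0..t1} xb t)) =
      integral {u..w} (\<lambda>t. L t (xb t) (v t))"
    using uwz N(2) by (intro spike) (auto simp: N'_def)
  moreover have "integral {w..z} (\<lambda>t. L t (xb t) (ddt {t0..t1} xb t)) =
      integral {w..z} (\<lambda>t. L t (xb t) (v t))"
    using uwz N(2) by (intro spike) (auto simp: N'_def)
  ultimately show ?thesis
    using split[OF x] split[OF xb] by simp
qed

subsection \<open>Expansion of the integrand\<close>

text \<open>All differentiation is done on the total derivative of the uncurried integrand, to which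
  \<open>Ck_on\<close> refers. The partial gradients reappear as its values in the directions
  \<open>(0, h, 0)\<close> and \<open>(0, 0, h)\<close>.\<close>

abbreviation DL :: "'n::finite lagrangian \<Rightarrow> real \<times> (real^'n) \<times> (real^'n)
    \<Rightarrow> real \<times> (real^'n) \<times> (real^'n) \<Rightarrow> real" where
  "DL L p \<equiv> frechet_derivative (\<lambda>(t, x, v). L t x v) (at p)"

lemma DL_has_derivative:
  fixes L :: "'n::finite lagrangian"
  assumes "Ck_on 2 (\<lambda>(t, x, v). L t x v) (A \<times> UNIV \<times> UNIV)" "t \<in> A"
  shows "((\<lambda>(t, x, v). L t x v) has_derivative DL L (t, x, v)) (at (t, x, v))"
  using assms by (intro Ck_on_2D(1)) auto

text \<open>Continuity of \<open>DL\<close> in the base point is available for a fixed direction,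
  but on a hat the direction \<open>(0, (t - c) *\<^sub>R k, k)\<close> moves with \<open>t\<close>.
  The splitting leaves two fixed directions and a scalar factor.\<close>

lemma DL_split:
  fixes L :: "'n::finite lagrangian"
  assumes "Ck_on 2 (\<lambda>(t, x, v). L t x v) (A \<times> UNIV \<times> UNIV)" "t \<in> A"
  shows "DL L (t, x, v) (0, r *\<^sub>R h, k) = r * DL L (t, x, v) (0, h, 0) + DL L (t, x, v) (0, 0, k)"
proof -
  interpret linear "DL L (t, x, v)"
    using DL_has_derivative[OF assms] by (rule has_derivative_linear)
  have "DL L (t, x, v) (r *\<^sub>R (0, h, 0) + (0, 0, k)) = r * DL L (t, x, v) (0, h, 0) + DL L (t, x, v) (0, 0, k)"
    by (simp only: add scale real_scaleR_def)
  then show ?thesis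
    by simp
qed

lemma L_x_inner:
  fixes L :: "'n::finite lagrangian"
  assumes "Ck_on 2 (\<lambda>(t, x, v). L t x v) (A \<times> UNIV \<times> UNIV)" "t \<in> A"
  shows "L_x L t x v \<bullet> h = DL L (t, x, v) (0, h, 0)"
proof -
  have "((\<lambda>y. (t, y, v)) has_derivative (\<lambda>h. (0, h, 0))) (at x)"
    by (auto intro!: derivative_eq_intros)
  from has_derivative_compose[OF this DL_has_derivative[OF assms]] show ?thesis
    unfolding L_x_def by (intro inner_gradient) simp
qed

lemma L_v_inner:
  fixes L :: "'n::finite lagrangian"
  assumes "Ck_on 2 (\<lambda>(t, x, v). L t x v) (A \<times> UNIV \<times> UNIV)" "t \<in> A"
  shows "L_v L t x v \<bullet> h = DL L (t, x, v) (0, 0, h)"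
proof -
  have "((\<lambda>w. (t, x, w)) has_derivative (\<lambda>h. (0, 0, h))) (at v)"
    by (auto intro!: derivative_eq_intros)
  from has_derivative_compose[OF this DL_has_derivative[OF assms]] show ?thesis
    unfolding L_v_def by (intro inner_gradient) simp
qed

text \<open>A Jacobian means something only once \<open>L_x\<close> is known to be differentiable in
  \<open>x\<close>. This is obtained componentwise from \<open>DL\<close> in the basis directions;
  uniqueness of the derivative of \<open>L_x\<close> contracted with \<open>h\<close> then
  identifies the form.\<close>

lemma L_xx_quadratic_form:
  fixes L :: "'n::finite lagrangian"
  assumes L: "Ck_on 2 (\<lambda>(t, x, v). L t x v) (A \<times> UNIV \<times> UNIV)" "t \<in> A"
  shows "h \<bullet> (L_xx L t x v *v h) =
    frechet_derivative (\<lambda>p. DL L p (0, h, 0)) (at (t, x, v)) (0, h, 0)"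
proof -
  have line: "((\<lambda>y. (t, y, v)) has_derivative (\<lambda>h. (0, h, 0))) (at x)"
    by (auto intro!: derivative_eq_intros)
  have D1: "((\<lambda>p. DL L p (0, k, 0)) has_derivative
      frechet_derivative (\<lambda>p. DL L p (0, k, 0)) (at (t, x, v))) (at (t, x, v))" for k
    using Ck_on_2D(2)[OF L(1)] L(2) by (auto simp flip: frechet_derivative_works)
  have D1x: "((\<lambda>y. DL L (t, y, v) (0, k, 0)) has_derivative
      (\<lambda>h. frechet_derivative (\<lambda>p. DL L p (0, k, 0)) (at (t, x, v)) (0, h, 0))) (at x)" for k
    using has_derivative_compose[OF line D1] .
  have "L_x L t y v = (\<Sum>b\<in>Basis. DL L (t, y, v) (0, b, 0) *\<^sub>R b)" for y
    using euclidean_representation[of "L_x L t y v"] by (simp add: L_x_inner[OF L])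
  moreover have "(\<lambda>y. \<Sum>b\<in>Basis. DL L (t, y, v) (0, b, 0) *\<^sub>R b) differentiable (at x)"
    using D1x by (intro differentiable_sum differentiable_scaleR ballI) (auto simp: differentiable_def)
  ultimately have "(\<lambda>y. L_x L t y v) differentiable (at x)"
    by simp
  then have "((\<lambda>y. L_x L t y v) has_derivative (\<lambda>h. L_xx L t x v *v h)) (at x)"
    unfolding L_xx_def by (simp add: jacobian_works)
  then have "((\<lambda>y. L_x L t y v \<bullet> h) has_derivative (\<lambda>k. (L_xx L t x v *v k) \<bullet> h)) (at x)"
    by (rule has_derivative_inner_left)
  then have "(\<lambda>k. (L_xx L t x v *v k) \<bullet> h) =
      (\<lambda>k. frechet_derivative (\<lambda>p. DL L p (0, h, 0)) (at (t, x, v)) (0, k, 0))"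
    unfolding L_x_inner[OF L] using D1x by (rule has_derivative_unique)
  from fun_cong[OF this, of h] show ?thesis
    by (simp add: inner_commute)
qed

lemma continuous_on_DL:
  fixes L :: "'n::finite lagrangian"
  assumes L: "Ck_on 2 (\<lambda>(t, x, v). L t x v) (A \<times> UNIV \<times> UNIV)"
    and "continuous_on T f" "f ` T \<subseteq> A \<times> UNIV \<times> UNIV"
  shows "continuous_on T (\<lambda>s. DL L (f s) k)"
proof -
  have "continuous_on (A \<times> UNIV \<times> UNIV) (\<lambda>p. DL L p k)"
    using Ck_on_2D(2)[OF L]
    by (intro continuous_at_imp_continuous_on ballI differentiable_imp_continuous_within)
  from continuous_on_compose2[OF this assms(2,3)] show ?thesis .
qed

lemma continuous_on_lagrangian:
  fixes L :: "'n::finite lagrangian"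
  assumes L: "Ck_on 2 (\<lambda>(t, x, v). L t x v) (A \<times> UNIV \<times> UNIV)"
    and "continuous_on T f" "continuous_on T g" "continuous_on T h" "f ` T \<subseteq> A"
  shows "continuous_on T (\<lambda>s. L (f s) (g s) (h s))"
proof -
  have "continuous_on (A \<times> UNIV \<times> UNIV) (\<lambda>(t, x, v). L t x v)"
    using L unfolding numeral_2_eq_2 by (rule Ck_on_continuous_on)
  moreover have "continuous_on T (\<lambda>s. (f s, g s, h s))"
    using assms by (intro continuous_intros)
  ultimately show ?thesis
    using assms(5) continuous_on_compose2[of "A \<times> UNIV \<times> UNIV" "\<lambda>(t, x, v). L t x v" T "\<lambda>s. (f s, g s, h s)"]
    by auto
qed

text \<open>One linear piece of the hat, extended to its zero \<open>c\<close>. The derivative of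
  the integrand in \<open>\<mu>\<close> is jointly continuous in \<open>\<mu>\<close> and
  \<open>t\<close>, which permits differentiation under the integral sign.\<close>

lemma first_variation_piece:
  fixes L :: "'n::finite lagrangian" and x v :: "real \<Rightarrow> real^'n"
  assumes L: "Ck_on 2 (\<lambda>(t, x, v). L t x v) (A \<times> UNIV \<times> UNIV)"
    and I: "{p..q} \<subseteq> A" and cont: "continuous_on {p..q} x" "continuous_on {p..q} v"
  shows "((\<lambda>\<mu>. integral {p..q} (\<lambda>t. L t (x t + (t - c) *\<^sub>R (\<mu> *\<^sub>R k)) (v t + \<mu> *\<^sub>R k)))
      has_field_derivative integral {p..q} (\<lambda>t. DL L (t, x t, v t) (0, (t - c) *\<^sub>R k, k))) (at 0)"
proof -
  let ?\<gamma> = "\<lambda>\<mu> t. (t, x t + (t - c) *\<^sub>R (\<mu> *\<^sub>R k), v t + \<mu> *\<^sub>R k)"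
  have "((\<lambda>\<mu>. integral (cbox p q) (\<lambda>t. L t (x t + (t - c) *\<^sub>R (\<mu> *\<^sub>R k)) (v t + \<mu> *\<^sub>R k)))
      has_field_derivative integral (cbox p q) (\<lambda>t. DL L (?\<gamma> 0 t) (0, (t - c) *\<^sub>R k, k))) (at 0)"
  proof (rule leibniz_rule_field_derivative[where U = UNIV
        and fx = "\<lambda>\<mu> t. DL L (?\<gamma> \<mu> t) (0, (t - c) *\<^sub>R k, k)"])
    fix \<mu> t assume "t \<in> cbox p q"
    then have "t \<in> A"
      using I by auto
    have "((\<lambda>\<mu>. ?\<gamma> \<mu> t) has_derivative (\<lambda>d. (0, d *\<^sub>R ((t - c) *\<^sub>R k), d *\<^sub>R k))) (at \<mu>)"
      by (auto intro!: derivative_eq_intros simp: mult.commute)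
    then have "((\<lambda>\<mu>. ?\<gamma> \<mu> t) has_vector_derivative (0, (t - c) *\<^sub>R k, k)) (at \<mu>)"
      by (simp add: has_vector_derivative_def)
    from vector_derivative_diff_chain_within[OF this has_derivative_at_withinI[OF DL_has_derivative[OF L \<open>t \<in> A\<close>]]]
    show "((\<lambda>\<mu>. L t (x t + (t - c) *\<^sub>R (\<mu> *\<^sub>R k)) (v t + \<mu> *\<^sub>R k)) has_field_derivative
        DL L (?\<gamma> \<mu> t) (0, (t - c) *\<^sub>R k, k)) (at \<mu>)"
      by (simp add: has_real_derivative_iff_has_vector_derivative o_def)
  next
    fix \<mu> :: real
    have "continuous_on {p..q} (\<lambda>t. L t (x t + (t - c) *\<^sub>R (\<mu> *\<^sub>R k)) (v t + \<mu> *\<^sub>R k))"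
      using I by (intro continuous_on_lagrangian[OF L] continuous_intros cont) auto
    then show "(\<lambda>t. L t (x t + (t - c) *\<^sub>R (\<mu> *\<^sub>R k)) (v t + \<mu> *\<^sub>R k)) integrable_on cbox p q"
      by (simp add: integrable_continuous_interval)
  next
    let ?T = "UNIV \<times> cbox p q"
    have "continuous_on ?T (\<lambda>s. x (snd s))" "continuous_on ?T (\<lambda>s. v (snd s))"
      by (intro continuous_on_compose2[OF cont(1)] continuous_on_compose2[OF cont(2)] continuous_intros; auto)+
    then have \<gamma>: "continuous_on ?T (\<lambda>s. ?\<gamma> (fst s) (snd s))"
      by (intro continuous_intros)
    have "continuous_on ?T (\<lambda>s. (snd s - c) * DL L (?\<gamma> (fst s) (snd s)) (0, k, 0) + DL L (?\<gamma> (fst s) (snd s)) (0, 0, k))"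
      using I by (intro continuous_on_add continuous_on_mult continuous_on_DL[OF L \<gamma>] continuous_intros) auto
    then show "continuous_on ?T (\<lambda>(\<mu>, t). DL L (?\<gamma> \<mu> t) (0, (t - c) *\<^sub>R k, k))"
      by (rule continuous_on_eq) (use I DL_split[OF L] in auto)
  qed auto
  then show ?thesis
    by simp
qed

text \<open>\<open>R\<close> is the whole increment of the integrand minus its linear part, not
  merely a quadratic term. Scaling both pieces by the same \<open>\<mu>\<close> of either sign makes
  \<open>\<mu> = 0\<close> an interior minimum; comparison with \<open>\<mu> = 1\<close> then yields
  the inequality for the unscaled hat.\<close>

lemma second_variation_nonneg:
  fixes L :: "'n::finite lagrangian" and x v :: "real \<Rightarrow> real^'n"
  defines "R \<equiv> \<lambda>c k t. L t (x t + (t - c) *\<^sub>R k) (v t + k) - L t (x t) (v t) -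
      DL L (t, x t, v t) (0, (t - c) *\<^sub>R k, k)"
  assumes L: "Ck_on 2 (\<lambda>(t, x, v). L t x v) (A \<times> UNIV \<times> UNIV)"
    and I: "{u..z} \<subseteq> A" "u < w" "w < z"
    and cont: "continuous_on {u..z} x" "continuous_on {u..z} v"
    and min: "\<And>\<mu>. \<bar>\<mu>\<bar> \<le> 1 \<Longrightarrow>
      integral {u..w} (\<lambda>t. L t (x t) (v t)) + integral {w..z} (\<lambda>t. L t (x t) (v t)) \<le>
      integral {u..w} (\<lambda>t. L t (x t + (t - u) *\<^sub>R (\<mu> *\<^sub>R a)) (v t + \<mu> *\<^sub>R a)) +
      integral {w..z} (\<lambda>t. L t (x t + (t - z) *\<^sub>R (\<mu> *\<^sub>R b)) (v t + \<mu> *\<^sub>R b))"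
  shows "R u a integrable_on {u..w}" and "R z b integrable_on {w..z}"
    and "0 \<le> integral {u..w} (R u a) + integral {w..z} (R z b)"
proof -
  define \<Phi> where "\<Phi> = (\<lambda>p q c k \<mu>. integral {p..q} (\<lambda>t. L t (x t + (t - c) *\<^sub>R (\<mu> *\<^sub>R k)) (v t + \<mu> *\<^sub>R k)))"
  define \<Phi>' where "\<Phi>' = (\<lambda>p q c k. integral {p..q} (\<lambda>t. DL L (t, x t, v t) (0, (t - c) *\<^sub>R k, k)))"
  have piece: "R c k integrable_on {p..q} \<and>
      integral {p..q} (R c k) = \<Phi> p q c k 1 - \<Phi> p q c k 0 - \<Phi>' p q c k \<and>
      (\<Phi> p q c k has_field_derivative \<Phi>' p q c k) (at 0)"
    if "{p..q} \<subseteq> {u..z}" for p q c k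
  proof -
    have A: "{p..q} \<subseteq> A"
      using that I by blast
    have xv: "continuous_on {p..q} x" "continuous_on {p..q} v"
      using cont that continuous_on_subset by blast+
    have "continuous_on {p..q} (\<lambda>t. (t - c) * DL L (t, x t, v t) (0, k, 0) + DL L (t, x t, v t) (0, 0, k))"
      using A by (intro continuous_on_add continuous_on_mult continuous_on_DL[OF L] continuous_intros xv) auto
    then have "continuous_on {p..q} (\<lambda>t. DL L (t, x t, v t) (0, (t - c) *\<^sub>R k, k))"
      by (rule continuous_on_eq) (use A DL_split[OF L] in auto)
    then have 1: "(\<lambda>t. DL L (t, x t, v t) (0, (t - c) *\<^sub>R k, k)) integrable_on {p..q}"
      by (rule integrable_continuous_interval)
    have 2: "(\<lambda>t. L t (x t + (t - c) *\<^sub>R k) (v t + k)) integrable_on {p..q}"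
      using A by (intro integrable_continuous_interval continuous_on_lagrangian[OF L] continuous_intros xv) auto
    have 3: "(\<lambda>t. L t (x t) (v t)) integrable_on {p..q}"
      using A by (intro integrable_continuous_interval continuous_on_lagrangian[OF L] continuous_intros xv) auto
    have "R c k integrable_on {p..q}"
      unfolding R_def by (intro integrable_diff 1 2 3)
    moreover have "integral {p..q} (R c k) = \<Phi> p q c k 1 - \<Phi> p q c k 0 - \<Phi>' p q c k"
      unfolding R_def \<Phi>_def \<Phi>'_def
      by (subst integral_diff[OF integrable_diff[OF 2 3] 1], subst integral_diff[OF 2 3]) simp
    ultimately show ?thesis
      using first_variation_piece[OF L A xv] by (simp add: \<Phi>_def \<Phi>'_def)
  qed
  have sub: "{u..w} \<subseteq> {u..z}" "{w..z} \<subseteq> {u..z}"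
    using I by auto
  show "R u a integrable_on {u..w}" "R z b integrable_on {w..z}"
    using piece sub by blast+
  have le: "\<Phi> u w u a 0 + \<Phi> w z z b 0 \<le> \<Phi> u w u a \<mu> + \<Phi> w z z b \<mu>" if "\<bar>\<mu>\<bar> \<le> 1" for \<mu>
    using min[OF that] by (simp add: \<Phi>_def)
  have "((\<lambda>\<mu>. \<Phi> u w u a \<mu> + \<Phi> w z z b \<mu>) has_field_derivative (\<Phi>' u w u a + \<Phi>' w z z b)) (at 0)"
    using piece sub by (intro DERIV_add) blast+
  \<comment> \<open>Only the sum vanishes: a single piece is not an admissible variation, because it
    does not return to zero.\<close>
  then have "\<Phi>' u w u a + \<Phi>' w z z b = 0"
    by (rule DERIV_local_min[of _ _ _ 1]) (use le in auto)
  then show "0 \<le> integral {u..w} (R u a) + integral {w..z} (R z b)"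
    using le[of 1] piece sub by auto
qed

text \<open>The remainder is quadratic in \<open>t - \<theta>\<close> and \<open>\<rho>\<close>
  jointly, so each ingredient is expanded as far as its factor requires. The slope
  \<open>\<xi>\<close> is kept apart from the direction \<open>\<eta>\<close> of the displacement:
  both pieces of the hat are displaced along the same \<open>\<eta>\<close>, with different slopes,
  and \<open>M_fun\<close> contracts with that common vector too.\<close>

lemma integrand_expansion:
  fixes L :: "'n::finite lagrangian" and x v :: "real \<Rightarrow> real^'n"
  assumes L: "Ck_on 2 (\<lambda>(t, x, v). L t x v) (A \<times> UNIV \<times> UNIV)"
    and Lv: "Ck_on 2 (\<lambda>(t, x, v). L_v L t x v) (A \<times> UNIV \<times> UNIV)"
    and "open A" and S: "convex S" "\<theta> \<in> S" "S \<subseteq> A"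
    and x: "\<And>t. t \<in> S \<Longrightarrow> (x has_vector_derivative v t) (at t within S)"
    and v: "\<And>t. t \<in> S \<Longrightarrow> (v has_vector_derivative v1 t) (at t within S)"
    and v1: "(v1 has_vector_derivative v2) (at \<theta> within S)"
  obtains e1 e2 p1 where
    "\<And>t. t \<in> S \<Longrightarrow> ((\<lambda>t. E_fun L x v t \<xi>) has_vector_derivative e1 t) (at t within S)"
    "(e1 has_vector_derivative e2) (at \<theta> within S)"
    "((\<lambda>t. Delta_L_x L x v t \<xi> \<bullet> \<eta>) has_vector_derivative p1) (at \<theta> within S)"
    "\<And>\<kappa>. \<kappa> > 0 \<Longrightarrow> \<exists>r>0. \<forall>t\<in>S. \<forall>\<rho>. \<bar>t - \<theta>\<bar> < r \<longrightarrow> \<bar>\<rho>\<bar> < r \<longrightarrow>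
      \<bar>L t (x t + \<rho> *\<^sub>R \<eta>) (v t + \<xi>) - L t (x t) (v t) - DL L (t, x t, v t) (0, \<rho> *\<^sub>R \<eta>, \<xi>) -
       (E_fun L x v \<theta> \<xi> + e1 \<theta> * (t - \<theta>) + e2 * (t - \<theta>)\<^sup>2 / 2 +
        \<rho> * (Delta_L_x L x v \<theta> \<xi> \<bullet> \<eta> + p1 * (t - \<theta>)) +
        \<rho>\<^sup>2 / 2 * (\<eta> \<bullet> (L_xx L \<theta> (x \<theta>) (v \<theta> + \<xi>) *v \<eta>)))\<bar> \<le> \<kappa> * ((t - \<theta>)\<^sup>2 + \<rho>\<^sup>2)"
proof -
  define \<gamma> where "\<gamma> = (\<lambda>\<xi> t. (t, x t, v t + \<xi>))"
  define \<gamma>1 where "\<gamma>1 = (\<lambda>t. (1::real, v t, v1 t))"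
  have \<gamma>_in: "\<gamma> \<xi> t \<in> A \<times> UNIV \<times> UNIV" if "t \<in> S" for t \<xi>
    using that S by (auto simp: \<gamma>_def)
  have \<gamma>: "(\<gamma> \<xi> has_vector_derivative \<gamma>1 t) (at t within S)" if "t \<in> S" for t \<xi>
    unfolding \<gamma>_def \<gamma>1_def using x[OF that] v[OF that]
    by (auto intro!: has_vector_derivative_Pair derivative_eq_intros)
  have \<gamma>1: "(\<gamma>1 has_vector_derivative (0, v1 \<theta>, v2)) (at \<theta> within S)"
    unfolding \<gamma>1_def using v[OF S(2)] v1
    by (auto intro!: has_vector_derivative_Pair derivative_eq_intros)
  note compose = compose_path_twice_differentiable[OF _ \<gamma>_in \<gamma> \<gamma>1 S(2)]

  obtain a1 a2 where a: "\<And>t. t \<in> S \<Longrightarrow> ((\<lambda>t. L t (x t) (v t + \<xi>)) has_vector_derivative a1 t) (at t within S)"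
    "(a1 has_vector_derivative a2) (at \<theta> within S)"
    using compose[OF L, of \<xi>] by (auto simp: \<gamma>_def)
  obtain b1 b2 where b: "\<And>t. t \<in> S \<Longrightarrow> ((\<lambda>t. L t (x t) (v t)) has_vector_derivative b1 t) (at t within S)"
    "(b1 has_vector_derivative b2) (at \<theta> within S)"
    using compose[OF L, of 0] by (auto simp: \<gamma>_def)
  obtain c1 c2 where c: "\<And>t. t \<in> S \<Longrightarrow> ((\<lambda>t. L_v L t (x t) (v t)) has_vector_derivative c1 t) (at t within S)"
    "(c1 has_vector_derivative c2) (at \<theta> within S)"
    using compose[OF Lv, of 0] by (auto simp: \<gamma>_def)
  note inner_left = bounded_linear.has_vector_derivative[OF bounded_linear_inner_left]
  define e1 where "e1 = (\<lambda>t. a1 t - b1 t - c1 t \<bullet> \<xi>)"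
  have E: "((\<lambda>t. E_fun L x v t \<xi>) has_vector_derivative e1 t) (at t within S)" if "t \<in> S" for t
    unfolding E_fun_def e1_def
    by (intro has_vector_derivative_diff a b inner_left c that)
  have e1: "(e1 has_vector_derivative (a2 - b2 - c2 \<bullet> \<xi>)) (at \<theta> within S)"
    unfolding e1_def by (intro has_vector_derivative_diff a b inner_left c)

  have "(\<lambda>t. DL L (\<gamma> \<xi>' t) (0, \<eta>, 0)) differentiable (at \<theta> within S)" for \<xi>'
  proof -
    have "(\<lambda>p. DL L p (0, \<eta>, 0)) differentiable (at (\<gamma> \<xi>' \<theta>) within \<gamma> \<xi>' ` S)"
      using Ck_on_2D(2)[OF L \<gamma>_in[OF S(2)]] by (rule differentiable_at_withinI)
    moreover have "\<gamma> \<xi>' differentiable (at \<theta> within S)"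
      using \<gamma>[OF S(2)] by (rule differentiableI_vector)
    ultimately show ?thesis
      using differentiable_chain_within[of "\<gamma> \<xi>'" \<theta> S "\<lambda>p. DL L p (0, \<eta>, 0)"] by (simp add: o_def)
  qed
  then have "(\<lambda>t. DL L (\<gamma> \<xi> t) (0, \<eta>, 0) - DL L (\<gamma> 0 t) (0, \<eta>, 0)) differentiable (at \<theta> within S)"
    by (intro differentiable_diff)
  then obtain p1 where "((\<lambda>t. DL L (\<gamma> \<xi> t) (0, \<eta>, 0) - DL L (\<gamma> 0 t) (0, \<eta>, 0)) has_vector_derivative p1) (at \<theta> within S)"
    by (auto simp: vector_derivative_works)
  then have P: "((\<lambda>t. Delta_L_x L x v t \<xi> \<bullet> \<eta>) has_vector_derivative p1) (at \<theta> within S)"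
    by (rule has_vector_derivative_transform[OF S(2), rotated])
      (use S(3) in \<open>auto simp: Delta_L_x_def \<gamma>_def inner_diff_left L_x_inner[OF L]\<close>)

  have "\<exists>r>0. \<forall>t\<in>S. \<forall>\<rho>. \<bar>t - \<theta>\<bar> < r \<longrightarrow> \<bar>\<rho>\<bar> < r \<longrightarrow>
      \<bar>L t (x t + \<rho> *\<^sub>R \<eta>) (v t + \<xi>) - L t (x t) (v t) - DL L (t, x t, v t) (0, \<rho> *\<^sub>R \<eta>, \<xi>) -
       (E_fun L x v \<theta> \<xi> + e1 \<theta> * (t - \<theta>) + (a2 - b2 - c2 \<bullet> \<xi>) * (t - \<theta>)\<^sup>2 / 2 +
        \<rho> * (Delta_L_x L x v \<theta> \<xi> \<bullet> \<eta> + p1 * (t - \<theta>)) +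
        \<rho>\<^sup>2 / 2 * (\<eta> \<bullet> (L_xx L \<theta> (x \<theta>) (v \<theta> + \<xi>) *v \<eta>)))\<bar> \<le> \<kappa> * ((t - \<theta>)\<^sup>2 + \<rho>\<^sup>2)"
    if "\<kappa> > 0" for \<kappa>
  proof -
    have open_\<Omega>: "open (A \<times> (UNIV :: (real^'n) set) \<times> (UNIV :: (real^'n) set))"
      using \<open>open A\<close> by (intro open_Times open_UNIV)
    \<comment> \<open>The errors are at most \<open>\<kappa>' * (t - \<theta>)\<^sup>2\<close>,
      \<open>\<kappa>' * ((t - \<theta>)\<^sup>2 + \<rho>\<^sup>2)\<close> and
      \<open>\<kappa>' * \<rho>\<^sup>2\<close>, together twice
      \<open>\<kappa>' * ((t - \<theta>)\<^sup>2 + \<rho>\<^sup>2)\<close>.\<close>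
    define \<kappa>' where "\<kappa>' = \<kappa> / 2"
    have "\<kappa>' > 0"
      using that by (simp add: \<kappa>'_def)
    obtain r1 where r1: "r1 > 0" "\<And>t. t \<in> S \<Longrightarrow> \<bar>t - \<theta>\<bar> < r1 \<Longrightarrow>
        \<bar>E_fun L x v t \<xi> - (E_fun L x v \<theta> \<xi> + e1 \<theta> * (t - \<theta>) + (a2 - b2 - c2 \<bullet> \<xi>) * (t - \<theta>)\<^sup>2 / 2)\<bar>
        \<le> \<kappa>' * (t - \<theta>)\<^sup>2"
      using Peano_second_order[OF S(1,2) E e1 \<open>\<kappa>' > 0\<close>] by blast
    obtain r2 where r2: "r2 > 0" "\<And>t. t \<in> S \<Longrightarrow> \<bar>t - \<theta>\<bar> < r2 \<Longrightarrow>
        \<bar>Delta_L_x L x v t \<xi> \<bullet> \<eta> - Delta_L_x L x v \<theta> \<xi> \<bullet> \<eta> - (t - \<theta>) * p1\<bar> \<le> \<kappa>' * \<bar>t - \<theta>\<bar>"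
      using P \<open>\<kappa>' > 0\<close> unfolding has_vector_derivative_def has_derivative_within_alt by fastforce
    obtain r3 where r3: "r3 > 0" "\<And>p \<rho>. dist p (\<gamma> \<xi> \<theta>) < r3 \<Longrightarrow> \<bar>\<rho>\<bar> < r3 \<Longrightarrow>
        \<bar>(\<lambda>(t, x, v). L t x v) (p + \<rho> *\<^sub>R (0, \<eta>, 0)) - ((\<lambda>(t, x, v). L t x v) p + \<rho> * DL L p (0, \<eta>, 0) +
          \<rho>\<^sup>2 / 2 * frechet_derivative (\<lambda>p. DL L p (0, \<eta>, 0)) (at (\<gamma> \<xi> \<theta>)) (0, \<eta>, 0))\<bar> \<le> \<kappa>' * \<rho>\<^sup>2"
      by (rule uniform_second_order_remainder[OF L open_\<Omega> \<gamma>_in[OF S(2), of \<xi>] \<open>\<kappa>' > 0\<close>, where k = "(0, \<eta>, 0)"])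
        blast
    have "continuous (at \<theta> within S) (\<gamma> \<xi>)"
      using \<gamma>[OF S(2)] by (rule has_vector_derivative_continuous)
    then obtain r4 where r4: "r4 > 0" "\<And>t. t \<in> S \<Longrightarrow> \<bar>t - \<theta>\<bar> < r4 \<Longrightarrow> dist (\<gamma> \<xi> t) (\<gamma> \<xi> \<theta>) < r3"
      using r3(1) unfolding continuous_within_eps_delta dist_real_def by blast
    define r where "r = Min {r1, r2, r3, r4}"
    have "r > 0"
      using r1(1) r2(1) r3(1) r4(1) by (simp add: r_def)
    moreover have "\<bar>L t (x t + \<rho> *\<^sub>R \<eta>) (v t + \<xi>) - L t (x t) (v t) - DL L (t, x t, v t) (0, \<rho> *\<^sub>R \<eta>, \<xi>) -
       (E_fun L x v \<theta> \<xi> + e1 \<theta> * (t - \<theta>) + (a2 - b2 - c2 \<bullet> \<xi>) * (t - \<theta>)\<^sup>2 / 2 +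
        \<rho> * (Delta_L_x L x v \<theta> \<xi> \<bullet> \<eta> + p1 * (t - \<theta>)) +
        \<rho>\<^sup>2 / 2 * (\<eta> \<bullet> (L_xx L \<theta> (x \<theta>) (v \<theta> + \<xi>) *v \<eta>)))\<bar> \<le> \<kappa> * ((t - \<theta>)\<^sup>2 + \<rho>\<^sup>2)"
      (is "\<bar>?Z\<bar> \<le> _") if t: "t \<in> S" "\<bar>t - \<theta>\<bar> < r" and \<rho>: "\<bar>\<rho>\<bar> < r" for t \<rho>
    proof -
      have "t \<in> A" "\<theta> \<in> A"
        using t S by auto
      define X where "X = E_fun L x v t \<xi> -
        (E_fun L x v \<theta> \<xi> + e1 \<theta> * (t - \<theta>) + (a2 - b2 - c2 \<bullet> \<xi>) * (t - \<theta>)\<^sup>2 / 2)"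
      define Y where "Y = Delta_L_x L x v t \<xi> \<bullet> \<eta> - Delta_L_x L x v \<theta> \<xi> \<bullet> \<eta> - (t - \<theta>) * p1"
      define U where "U = L t (x t + \<rho> *\<^sub>R \<eta>) (v t + \<xi>) - (L t (x t) (v t + \<xi>) + \<rho> * (L_x L t (x t) (v t + \<xi>) \<bullet> \<eta>) +
        \<rho>\<^sup>2 / 2 * (\<eta> \<bullet> (L_xx L \<theta> (x \<theta>) (v \<theta> + \<xi>) *v \<eta>)))"
      \<comment> \<open>\<open>X\<close> is the error of the excess in time, \<open>Y\<close> that
        of the increment of \<open>L_x\<close> in time, and \<open>U\<close> that of the Taylor
        formula in the displacement at the moving base point.\<close>
      have "?Z = X + \<rho> * Y + U"
        by (simp add: X_def Y_def U_def E_fun_def Delta_L_x_def DL_split[OF L \<open>t \<in> A\<close>]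
            L_x_inner[OF L \<open>t \<in> A\<close>] L_v_inner[OF L \<open>t \<in> A\<close>] inner_diff_left algebra_simps)
      then have "\<bar>?Z\<bar> \<le> \<bar>X\<bar> + \<bar>\<rho>\<bar> * \<bar>Y\<bar> + \<bar>U\<bar>"
        by (simp flip: abs_mult)
      moreover have "\<bar>X\<bar> \<le> \<kappa>' * (t - \<theta>)\<^sup>2"
        unfolding X_def using t by (intro r1) (auto simp: r_def)
      moreover have "\<bar>\<rho>\<bar> * \<bar>Y\<bar> \<le> \<bar>\<rho>\<bar> * (\<kappa>' * \<bar>t - \<theta>\<bar>)"
        unfolding Y_def using t by (intro mult_left_mono r2) (auto simp: r_def)
      moreover have "\<bar>\<rho>\<bar> * (\<kappa>' * \<bar>t - \<theta>\<bar>) \<le> \<kappa>' * ((t - \<theta>)\<^sup>2 + \<rho>\<^sup>2)"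
      proof -
        have "\<bar>\<rho>\<bar> * \<bar>t - \<theta>\<bar> \<le> (t - \<theta>)\<^sup>2 + \<rho>\<^sup>2"
          using sum_squares_bound[of "\<bar>\<rho>\<bar>" "\<bar>t - \<theta>\<bar>"] mult_nonneg_nonneg[of "\<bar>\<rho>\<bar>" "\<bar>t - \<theta>\<bar>"]
          by (simp del: mult_nonneg_nonneg)
        with \<open>\<kappa>' > 0\<close> show ?thesis
          by (simp add: mult.left_commute)
      qed
      moreover have "\<bar>U\<bar> \<le> \<kappa>' * \<rho>\<^sup>2"
        using r3(2)[of "\<gamma> \<xi> t" \<rho>] r4(2)[of t] t \<rho>
        by (simp add: U_def r_def \<gamma>_def L_x_inner[OF L \<open>t \<in> A\<close>] L_xx_quadratic_form[OF L \<open>\<theta> \<in> A\<close>])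
      ultimately show ?thesis
        by (simp add: \<kappa>'_def algebra_simps)
    qed
    ultimately show ?thesis
      by blast
  qed
  with E e1 P show ?thesis
    by (rule that)
qed

subsection \<open>The third-order expansion of the increment\<close>

text \<open>The integrand is known only up to a uniform error \<open>K\<close>; the integral of its
  polynomial model is evaluated through an explicit antiderivative.\<close>

lemma integral_near_antiderivative:
  fixes F P H :: "real \<Rightarrow> real"
  assumes "p \<le> q" and F: "F integrable_on {p..q}"
    and H: "\<And>t. t \<in> {p..q} \<Longrightarrow> (H has_field_derivative P t) (at t)"
    and K: "\<And>t. t \<in> {p..q} \<Longrightarrow> \<bar>F t - P t\<bar> \<le> K"
  shows "\<bar>integral {p..q} F - (H q - H p)\<bar> \<le> K * (q - p)"
proof -
  have P: "(P has_integral (H q - H p)) {p..q}"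
    using H \<open>p \<le> q\<close>
    by (intro fundamental_theorem_of_calculus)
      (auto simp flip: has_real_derivative_iff_has_vector_derivative intro: DERIV_subset)
  have FP: "((\<lambda>t. F t - P t) has_integral (integral {p..q} F - (H q - H p))) {p..q}"
    using has_integral_diff[OF integrable_integral[OF F] P] .
  have "K \<ge> 0"
    using K[of p] \<open>p \<le> q\<close> by simp
  then have "norm (integral {p..q} F - (H q - H p)) \<le> K * measure lborel (cbox p q)"
    using FP K by (intro has_integral_bound[where f = "\<lambda>t. F t - P t"]) auto
  then show ?thesis
    using \<open>p \<le> q\<close> by simp
qed

text \<open>This is where the weights of \<open>Q_fun\<close> and \<open>M_fun\<close> originate.
  With \<open>s = t - \<theta>\<close>, \<open>H1\<close> and \<open>H2\<close> are antiderivatives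
  of the models on the two pieces, whose displacements along \<open>\<eta>\<close> are
  \<open>s\<close> and \<open>c * (\<epsilon> - s)\<close>. The moments of
  \<open>s ^ (i - 1)\<close> over the pieces from 0 to \<open>lam * \<epsilon>\<close> and on to
  \<open>\<epsilon>\<close> are proportional to \<open>lam ^ i\<close> and
  \<open>1 - lam ^ i\<close>, the weights of \<open>Q_fun i\<close>. No sign of
  \<open>\<epsilon>\<close> is assumed, so the identity serves hats on either side.\<close>

lemma hat_variation_coefficients:
  fixes lam \<epsilon> e1 e2 f1 f2 p p' p1 p1' q q' :: real
  assumes "lam \<noteq> 1"
  defines "c \<equiv> lam / (1 - lam)"
  defines "H1 \<equiv> \<lambda>s. e1 * s^2 / 2 + e2 * s^3 / 6 + p * s^2 / 2 + p1 * s^3 / 3 + q * s^3 / 6"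
  defines "H2 \<equiv> \<lambda>s. f1 * s^2 / 2 + f2 * s^3 / 6 - c * p' * (\<epsilon> - s)^2 / 2 +
    c * p1' * (\<epsilon> * s^2 / 2 - s^3 / 3) - c^2 * q' * (\<epsilon> - s)^3 / 6"
  shows "(H1 (lam * \<epsilon>) - H1 0) + (H2 \<epsilon> - H2 (lam * \<epsilon>)) =
    \<epsilon>^2 / 2 * (lam * (lam * p + (1 - lam) * p') + (lam^2 * e1 + (1 - lam^2) * f1)) +
    \<epsilon>^3 / 6 * (lam^2 * (lam * q + (1 - lam) * q') +
      2 * lam * (lam^2 * p1 + (1 - lam) * (1/2 + lam) * p1') + (lam^3 * e2 + (1 - lam^3) * f2))"
proof -
  have c: "c * (1 - lam) = lam"
    using assms(1) by (simp add: c_def)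
  have 1: "c * (\<epsilon> - lam * \<epsilon>)^2 = lam * (1 - lam) * \<epsilon>^2"
  proof -
    have "c * (\<epsilon> - lam * \<epsilon>)^2 = (c * (1 - lam)) * (1 - lam) * \<epsilon>^2"
      by algebra
    then show ?thesis
      by (simp add: c)
  qed
  have 2: "c^2 * (\<epsilon> - lam * \<epsilon>)^3 = lam^2 * (1 - lam) * \<epsilon>^3"
  proof -
    have "c^2 * (\<epsilon> - lam * \<epsilon>)^3 = (c * (1 - lam))^2 * (1 - lam) * \<epsilon>^3"
      by algebra
    then show ?thesis
      by (simp add: c)
  qed
  \<comment> \<open>This is the integral of \<open>c * (\<epsilon> - s) * s\<close> from
    \<open>lam * \<epsilon>\<close> to \<open>\<epsilon>\<close>, the source of the factor
    \<open>1/2 + lam\<close> in \<open>M_fun 2\<close>.\<close>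
  have 3: "c * (\<epsilon> * \<epsilon>^2 / 2 - \<epsilon>^3 / 3) - c * (\<epsilon> * (lam * \<epsilon>)^2 / 2 - (lam * \<epsilon>)^3 / 3) =
    lam * (1 - lam) * (1/2 + lam) / 3 * \<epsilon>^3"
  proof -
    have "c * (\<epsilon> * \<epsilon>^2 / 2 - \<epsilon>^3 / 3) - c * (\<epsilon> * (lam * \<epsilon>)^2 / 2 - (lam * \<epsilon>)^3 / 3) =
        (c * (1 - lam)) * (1 - lam) * (1/2 + lam) / 3 * \<epsilon>^3"
      by (simp add: field_simps power2_eq_square power3_eq_cube)
    then show ?thesis
      by (simp add: c)
  qed
  have "(H1 (lam * \<epsilon>) - H1 0) + (H2 \<epsilon> - H2 (lam * \<epsilon>)) =
    e1 * (lam * \<epsilon>)^2 / 2 + e2 * (lam * \<epsilon>)^3 / 6 + p * (lam * \<epsilon>)^2 / 2 + p1 * (lam * \<epsilon>)^3 / 3 +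
    q * (lam * \<epsilon>)^3 / 6 + f1 * (\<epsilon>^2 - (lam * \<epsilon>)^2) / 2 + f2 * (\<epsilon>^3 - (lam * \<epsilon>)^3) / 6 +
    p' * (c * (\<epsilon> - lam * \<epsilon>)^2) / 2 +
    p1' * (c * (\<epsilon> * \<epsilon>^2 / 2 - \<epsilon>^3 / 3) - c * (\<epsilon> * (lam * \<epsilon>)^2 / 2 - (lam * \<epsilon>)^3 / 3)) +
    q' * (c^2 * (\<epsilon> - lam * \<epsilon>)^3) / 6"
    unfolding H1_def H2_def by (simp add: algebra_simps diff_divide_distrib add_divide_distrib)
  also have "\<dots> = \<epsilon>^2 / 2 * (lam * (lam * p + (1 - lam) * p') + (lam^2 * e1 + (1 - lam^2) * f1)) +
    \<epsilon>^3 / 6 * (lam^2 * (lam * q + (1 - lam) * q') +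
      2 * lam * (lam^2 * p1 + (1 - lam) * (1/2 + lam) * p1') + (lam^3 * e2 + (1 - lam^3) * f2))"
    unfolding 1 2 3 by (simp add: field_simps power2_eq_square power3_eq_cube)
  finally show ?thesis .
qed

text \<open>\<open>T\<close> is the set in the definition, a half-line or the whole line, and
  \<open>S\<close> the interval on which the trajectory is smooth; \<open>ddt\<close> depends on
  either only through the filter at \<open>\<theta>\<close>.\<close>

lemma W_fun_eq:
  assumes T: "at \<theta> within T = at \<theta> within S" "at \<theta> within S \<noteq> bot"
    and e1: "((\<lambda>t. E_fun L x v t \<xi>) has_vector_derivative e1) (at \<theta> within S)"
    and f1: "((\<lambda>t. E_fun L x v t ((lam / (lam - 1)) *\<^sub>R \<xi>)) has_vector_derivative f1) (at \<theta> within S)"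
  shows "W_fun T L x v \<theta> lam \<xi> =
    lam * (lam * (Delta_L_x L x v \<theta> \<xi> \<bullet> \<xi>) +
      (1 - lam) * (Delta_L_x L x v \<theta> ((lam / (lam - 1)) *\<^sub>R \<xi>) \<bullet> \<xi>)) +
    (lam^2 * e1 + (1 - lam^2) * f1)"
proof -
  have "((\<lambda>t. Q_fun 2 L x v t lam \<xi>) has_vector_derivative (lam^2 * e1 + (1 - lam^2) * f1)) (at \<theta> within S)"
    unfolding Q_fun_def using e1 f1
    by (intro has_vector_derivative_add has_vector_derivative_mult_right)
  then have "ddt T (\<lambda>t. Q_fun 2 L x v t lam \<xi>) \<theta> = lam^2 * e1 + (1 - lam^2) * f1"
    unfolding ddt_def T(1) using T(2) by (intro vector_derivative_within)
  then show ?thesis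
    by (simp add: W_fun_def M_fun_def)
qed

text \<open>The outer \<open>ddt\<close> sees the inner one at all points near
  \<open>\<theta>\<close>, so the filters of \<open>T\<close> and \<open>S\<close> must agree on the
  whole of \<open>S\<close>.\<close>

lemma G_fun_eq:
  assumes T: "\<And>t. t \<in> S \<Longrightarrow> at t within T = at t within S" "\<And>t. t \<in> S \<Longrightarrow> at t within S \<noteq> bot"
    and "\<theta> \<in> S"
    and e1: "\<And>t. t \<in> S \<Longrightarrow> ((\<lambda>t. E_fun L x v t \<xi>) has_vector_derivative e1 t) (at t within S)"
    and e2: "(e1 has_vector_derivative e2) (at \<theta> within S)"
    and f1: "\<And>t. t \<in> S \<Longrightarrow>
      ((\<lambda>t. E_fun L x v t ((lam / (lam - 1)) *\<^sub>R \<xi>)) has_vector_derivative f1 t) (at t within S)"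
    and f2: "(f1 has_vector_derivative f2) (at \<theta> within S)"
    and p1: "((\<lambda>t. Delta_L_x L x v t \<xi> \<bullet> \<xi>) has_vector_derivative p1) (at \<theta> within S)"
    and p1': "((\<lambda>t. Delta_L_x L x v t ((lam / (lam - 1)) *\<^sub>R \<xi>) \<bullet> \<xi>) has_vector_derivative p1')
      (at \<theta> within S)"
  shows "G_fun T L x v \<theta> lam \<xi> =
    lam^2 * (lam * (\<xi> \<bullet> (L_xx L \<theta> (x \<theta>) (v \<theta> + \<xi>) *v \<xi>)) +
      (1 - lam) * (\<xi> \<bullet> (L_xx L \<theta> (x \<theta>) (v \<theta> + (lam / (lam - 1)) *\<^sub>R \<xi>) *v \<xi>))) +
    2 * lam * (lam^2 * p1 + (1 - lam) * (1/2 + lam) * p1') +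
    (lam^3 * e2 + (1 - lam^3) * f2)"
proof -
  have ddt_eqI: "ddt T f t = f'" if "t \<in> S" "(f has_vector_derivative f') (at t within S)"
    for f :: "real \<Rightarrow> real" and f' t
    unfolding ddt_def T(1)[OF that(1)] using T(2)[OF that(1)] that(2) by (rule vector_derivative_within)
  have M: "ddt T (\<lambda>t. M_fun 2 L x v t lam \<xi>) \<theta> = lam^2 * p1 + (1 - lam) * (1/2 + lam) * p1'"
    unfolding M_fun_def
    by (intro ddt_eqI[OF \<open>\<theta> \<in> S\<close>] has_vector_derivative_add)
      (use has_vector_derivative_mult_right[OF p1] has_vector_derivative_mult_right[OF p1'] in simp_all)
  have Q: "ddt T (\<lambda>t. Q_fun 3 L x v t lam \<xi>) t = lam^3 * e1 t + (1 - lam^3) * f1 t" if "t \<in> S" for t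
    unfolding Q_fun_def using e1[OF that] f1[OF that]
    by (intro ddt_eqI[OF that] has_vector_derivative_add has_vector_derivative_mult_right)
  have "((\<lambda>t. lam^3 * e1 t + (1 - lam^3) * f1 t) has_vector_derivative (lam^3 * e2 + (1 - lam^3) * f2))
      (at \<theta> within S)"
    using e2 f2 by (intro has_vector_derivative_add has_vector_derivative_mult_right)
  then have "(ddt T (\<lambda>t. Q_fun 3 L x v t lam \<xi>) has_vector_derivative (lam^3 * e2 + (1 - lam^3) * f2))
      (at \<theta> within S)"
    by (rule has_vector_derivative_transform[OF \<open>\<theta> \<in> S\<close> Q, rotated])
  then have "ddt T (ddt T (\<lambda>t. Q_fun 3 L x v t lam \<xi>)) \<theta> = lam^3 * e2 + (1 - lam^3) * f2"
    by (rule ddt_eqI[OF \<open>\<theta> \<in> S\<close>])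
  moreover have "\<xi> \<bullet> ((lam *\<^sub>R X + (1 - lam) *\<^sub>R Y) *v \<xi>) = lam * (\<xi> \<bullet> (X *v \<xi>)) + (1 - lam) * (\<xi> \<bullet> (Y *v \<xi>))"
    for X Y :: "real^'a^'a"
    by (simp add: matrix_vector_mult_add_rdistrib inner_add_right scaleR_matrix_vector_assoc[symmetric])
  ultimately show ?thesis
    using M by (simp add: G_fun_def)
qed

text \<open>The factor \<open>sgn \<epsilon>\<close> arises because for \<open>\<epsilon> < 0\<close> the hat lies to the left of \<open>\<theta>\<close>: the same
  polynomial is then integrated over \<open>[\<theta> + \<epsilon>, \<theta>]\<close> instead of \<open>[\<theta>, \<theta> + \<epsilon>]\<close>.\<close>

lemma weak_local_min_third_order:
  fixes L :: "'n::finite lagrangian" and xb v :: "real \<Rightarrow> real^'n"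
  assumes I: "t0 < t1" "{t0..t1} \<subseteq> A" "open A"
    and L: "Ck_on 2 (\<lambda>(t, x, v). L t x v) (A \<times> UNIV \<times> UNIV)"
    and Lv: "Ck_on 2 (\<lambda>(t, x, v). L_v L t x v) (A \<times> UNIV \<times> UNIV)"
    and adm: "admissible t0 t1 x0 x1 xb"
    and min: "\<And>x. admissible t0 t1 x0 x1 x \<Longrightarrow>
        max (C_norm t0 t1 (\<lambda>t. x t - xb t))
            (Linf_norm t0 t1 (\<lambda>t. ddt {t0..t1} x t - ddt {t0..t1} xb t)) \<le> ereal \<delta> \<Longrightarrow>
        J L t0 t1 x \<ge> J L t0 t1 xb"
    and S: "convex S" "\<theta> \<in> S" "S \<subseteq> {t0..t1}"
    and T: "\<And>t. t \<in> S \<Longrightarrow> at t within T = at t within S" "\<And>t. t \<in> S \<Longrightarrow> at t within S \<noteq> bot"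
    and x: "\<And>t. t \<in> S \<Longrightarrow> (xb has_vector_derivative v t) (at t within S)"
    and v: "\<And>t. t \<in> S \<Longrightarrow> (v has_vector_derivative v1 t) (at t within S)"
    and v1: "(v1 has_vector_derivative v2) (at \<theta> within S)"
    and vb: "\<And>t. t \<in> S \<Longrightarrow> t \<noteq> \<theta> \<Longrightarrow> ddt {t0..t1} xb t = v t"
    and lam: "0 < lam" "lam < 1" and \<eta>: "norm \<eta> \<le> \<delta>" "norm ((lam / (lam - 1)) *\<^sub>R \<eta>) \<le> \<delta>"
    and E0: "E_fun L xb v \<theta> \<eta> = 0" "E_fun L xb v \<theta> ((lam / (lam - 1)) *\<^sub>R \<eta>) = 0"
    and "\<kappa> > 0"
  shows "\<exists>r>0. \<forall>\<epsilon>. \<theta> + \<epsilon> \<in> S \<longrightarrow> \<epsilon> \<noteq> 0 \<longrightarrow> \<bar>\<epsilon>\<bar> < r \<longrightarrow>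
    0 \<le> sgn \<epsilon> * (\<epsilon>^2 / 2 * W_fun T L xb v \<theta> lam \<eta> + \<epsilon>^3 / 6 * G_fun T L xb v \<theta> lam \<eta>) + \<kappa> * \<bar>\<epsilon>\<bar>^3"
proof -
  define \<zeta> where "\<zeta> = (lam / (lam - 1)) *\<^sub>R \<eta>"
  \<comment> \<open>The hat closes when
    \<open>lam *\<^sub>R \<eta> + (1 - lam) *\<^sub>R \<zeta> = 0\<close>; hence
    \<open>\<zeta>\<close> is \<open>\<eta>\<close> times \<open>- c\<close>.\<close>
  define c where "c = lam / (1 - lam)"
  have "c > 0"
    using lam by (simp add: c_def)
  have \<zeta>_eq: "\<zeta> = (- c) *\<^sub>R \<eta>"
  proof -
    have "lam / (lam - 1) = - c"
      using lam by (simp add: c_def field_simps)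
    then show ?thesis
      by (simp only: \<zeta>_def)
  qed
  have S_A: "S \<subseteq> A"
    using S I by blast
  note expansion = integrand_expansion[OF L Lv \<open>open A\<close> S(1,2) S_A x v v1, where \<eta> = \<eta>]
  define R where "R = (\<lambda>c k t. L t (xb t + (t - c) *\<^sub>R k) (v t + k) - L t (xb t) (v t) -
      DL L (t, xb t, v t) (0, (t - c) *\<^sub>R k, k))"
  define Z where "Z = (\<lambda>\<xi> \<rho> t. L t (xb t + \<rho> *\<^sub>R \<eta>) (v t + \<xi>) - L t (xb t) (v t) -
      DL L (t, xb t, v t) (0, \<rho> *\<^sub>R \<eta>, \<xi>))"
  define p where "p = (\<lambda>\<xi>. Delta_L_x L xb v \<theta> \<xi> \<bullet> \<eta>)"
  define q where "q = (\<lambda>\<xi>. \<eta> \<bullet> (L_xx L \<theta> (xb \<theta>) (v \<theta> + \<xi>) *v \<eta>))"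
  obtain e1 e2 p1 where e:
    "\<And>t. t \<in> S \<Longrightarrow> ((\<lambda>t. E_fun L xb v t \<eta>) has_vector_derivative e1 t) (at t within S)"
    "(e1 has_vector_derivative e2) (at \<theta> within S)"
    "((\<lambda>t. Delta_L_x L xb v t \<eta> \<bullet> \<eta>) has_vector_derivative p1) (at \<theta> within S)"
    and e_le: "\<And>\<kappa>. \<kappa> > 0 \<Longrightarrow> \<exists>r>0. \<forall>t\<in>S. \<forall>\<rho>. \<bar>t - \<theta>\<bar> < r \<longrightarrow> \<bar>\<rho>\<bar> < r \<longrightarrow>
      \<bar>Z \<eta> \<rho> t - (E_fun L xb v \<theta> \<eta> + e1 \<theta> * (t - \<theta>) + e2 * (t - \<theta>)\<^sup>2 / 2 +
        \<rho> * (p \<eta> + p1 * (t - \<theta>)) + \<rho>\<^sup>2 / 2 * q \<eta>)\<bar> \<le> \<kappa> * ((t - \<theta>)\<^sup>2 + \<rho>\<^sup>2)"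
    by (rule expansion[of \<eta>]) (assumption+, rule that, unfold Z_def p_def q_def)
  obtain f1 f2 p1' where f:
    "\<And>t. t \<in> S \<Longrightarrow> ((\<lambda>t. E_fun L xb v t \<zeta>) has_vector_derivative f1 t) (at t within S)"
    "(f1 has_vector_derivative f2) (at \<theta> within S)"
    "((\<lambda>t. Delta_L_x L xb v t \<zeta> \<bullet> \<eta>) has_vector_derivative p1') (at \<theta> within S)"
    and f_le: "\<And>\<kappa>. \<kappa> > 0 \<Longrightarrow> \<exists>r>0. \<forall>t\<in>S. \<forall>\<rho>. \<bar>t - \<theta>\<bar> < r \<longrightarrow> \<bar>\<rho>\<bar> < r \<longrightarrow>
      \<bar>Z \<zeta> \<rho> t - (E_fun L xb v \<theta> \<zeta> + f1 \<theta> * (t - \<theta>) + f2 * (t - \<theta>)\<^sup>2 / 2 +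
        \<rho> * (p \<zeta> + p1' * (t - \<theta>)) + \<rho>\<^sup>2 / 2 * q \<zeta>)\<bar> \<le> \<kappa> * ((t - \<theta>)\<^sup>2 + \<rho>\<^sup>2)"
    by (rule expansion[of \<zeta>]) (assumption+, rule that, unfold Z_def p_def q_def)
  define W where "W = W_fun T L xb v \<theta> lam \<eta>"
  define G where "G = G_fun T L xb v \<theta> lam \<eta>"
  have W: "W = lam * (lam * p \<eta> + (1 - lam) * p \<zeta>) + (lam^2 * e1 \<theta> + (1 - lam^2) * f1 \<theta>)"
    unfolding W_def p_def \<zeta>_def
    by (rule W_fun_eq[OF T(1)[OF S(2)] T(2)[OF S(2)]]) (use e f S(2) in \<open>auto simp: \<zeta>_def\<close>)
  have G: "G = lam^2 * (lam * q \<eta> + (1 - lam) * q \<zeta>) +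
      2 * lam * (lam^2 * p1 + (1 - lam) * (1/2 + lam) * p1') + (lam^3 * e2 + (1 - lam^3) * f2)"
    unfolding G_def q_def \<zeta>_def
    by (rule G_fun_eq[OF T S(2) e(1,2) f(1,2)[unfolded \<zeta>_def] e(3) f(3)[unfolded \<zeta>_def]])

  \<comment> \<open>The displacement \<open>\<rho>\<close> is at most
    \<open>\<bar>\<epsilon>\<bar>\<close> on one piece and \<open>c * \<bar>\<epsilon>\<bar>\<close>
    on the other, so \<open>(t - \<theta>)\<^sup>2 + \<rho>\<^sup>2\<close> is bounded by
    \<open>(2 + c^2) * \<epsilon>^2\<close> on both.\<close>
  define \<kappa>' where "\<kappa>' = \<kappa> / (2 + c^2)"
  have c2: "2 + c^2 > 0"
    by (simp add: add_pos_nonneg)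
  then have "\<kappa>' > 0"
    using \<open>\<kappa> > 0\<close> by (simp add: \<kappa>'_def)
  obtain r1 where r1: "r1 > 0" "\<And>t \<rho>. t \<in> S \<Longrightarrow> \<bar>t - \<theta>\<bar> < r1 \<Longrightarrow> \<bar>\<rho>\<bar> < r1 \<Longrightarrow>
      \<bar>Z \<eta> \<rho> t - (e1 \<theta> * (t - \<theta>) + e2 * (t - \<theta>)\<^sup>2 / 2 +
        \<rho> * (p \<eta> + p1 * (t - \<theta>)) + \<rho>\<^sup>2 / 2 * q \<eta>)\<bar> \<le> \<kappa>' * ((t - \<theta>)\<^sup>2 + \<rho>\<^sup>2)"
    using e_le[OF \<open>\<kappa>' > 0\<close>] unfolding E0 add_0 by blast
  obtain r2 where r2: "r2 > 0" "\<And>t \<rho>. t \<in> S \<Longrightarrow> \<bar>t - \<theta>\<bar> < r2 \<Longrightarrow> \<bar>\<rho>\<bar> < r2 \<Longrightarrow>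
      \<bar>Z \<zeta> \<rho> t - (f1 \<theta> * (t - \<theta>) + f2 * (t - \<theta>)\<^sup>2 / 2 +
        \<rho> * (p \<zeta> + p1' * (t - \<theta>)) + \<rho>\<^sup>2 / 2 * q \<zeta>)\<bar> \<le> \<kappa>' * ((t - \<theta>)\<^sup>2 + \<rho>\<^sup>2)"
    using f_le[OF \<open>\<kappa>' > 0\<close>] unfolding E0[folded \<zeta>_def] add_0 by blast
  \<comment> \<open>The bound 1 keeps the hat no longer than 1; the divisor \<open>1 + c\<close>
    brings both \<open>\<bar>\<epsilon>\<bar>\<close> and \<open>c * \<bar>\<epsilon>\<bar>\<close>
    below \<open>r1\<close> and \<open>r2\<close>.\<close>
  define r where "r = min 1 (min r1 r2 / (1 + c))"
  have "r > 0"
    using r1(1) r2(1) \<open>c > 0\<close> by (simp add: r_def)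
  moreover have "0 \<le> sgn \<epsilon> * (\<epsilon>^2 / 2 * W + \<epsilon>^3 / 6 * G) + \<kappa> * \<bar>\<epsilon>\<bar>^3"
    if \<epsilon>: "\<theta> + \<epsilon> \<in> S" "\<epsilon> \<noteq> 0" "\<bar>\<epsilon>\<bar> < r" for \<epsilon>
  proof -
    define u where "u = min \<theta> (\<theta> + \<epsilon>)"
    define z where "z = max \<theta> (\<theta> + \<epsilon>)"
    define w where "w = \<theta> + lam * \<epsilon>"
    have "\<bar>\<epsilon>\<bar> < 1" "\<bar>\<epsilon>\<bar> * (1 + c) < min r1 r2"
      using \<epsilon>(3) \<open>c > 0\<close> by (auto simp: r_def pos_less_divide_eq)
    then have "\<bar>\<epsilon>\<bar> + c * \<bar>\<epsilon>\<bar> < r1" "\<bar>\<epsilon>\<bar> + c * \<bar>\<epsilon>\<bar> < r2" "\<bar>\<epsilon>\<bar> < 1"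
      by (simp_all add: distrib_left mult.commute)
    moreover have "0 < c * \<bar>\<epsilon>\<bar>"
      using \<open>c > 0\<close> \<epsilon>(2) by simp
    ultimately have small: "\<bar>\<epsilon>\<bar> < 1" "\<bar>\<epsilon>\<bar> < r1" "\<bar>\<epsilon>\<bar> < r2" "c * \<bar>\<epsilon>\<bar> < r2"
      using \<epsilon>(2) by linarith+
    have sub: "{u..z} \<subseteq> S"
    proof -
      have "u \<in> S" "z \<in> S"
        using S(2) \<epsilon>(1) by (auto simp: u_def z_def min_def max_def)
      then show ?thesis
        using S(1) mem_is_interval_1_I[of S u z] by (auto simp: is_interval_convex_1)
    qed
    have uwz: "u < w" "w < z" "z - u \<le> 1"
    proof -
      have "lam * \<epsilon> < \<epsilon> \<and> 0 < lam * \<epsilon> \<or> \<epsilon> < lam * \<epsilon> \<and> lam * \<epsilon> < 0"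
      proof (cases "\<epsilon> > 0")
        case True
        then show ?thesis
          using lam by simp
      next
        case False
        then show ?thesis
          using lam \<epsilon>(2) by (simp add: mult_less_0_iff)
      qed
      then show "u < w" "w < z" "z - u \<le> 1"
        using small(1) unfolding u_def w_def z_def by (elim disjE conjE; linarith)+
    qed
    have tuz: "\<bar>t - \<theta>\<bar> \<le> \<bar>\<epsilon>\<bar>" "\<bar>t - (\<theta> + \<epsilon>)\<bar> \<le> \<bar>\<epsilon>\<bar>" "t \<in> S" if "t \<in> {u..z}" for t
      using that sub by (auto simp: u_def z_def min_def max_def split: if_splits)
    have u_z: "t0 \<le> u" "z \<le> t1"
      using subset_trans[OF sub S(3)] uwz by auto
    \<comment> \<open>The slope \<open>\<eta>\<close> belongs to the piece adjacent to
      \<open>\<theta>\<close>, which comes second in time when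
      \<open>\<epsilon> < 0\<close>.\<close>
    define a where "a = (if \<epsilon> > 0 then \<eta> else \<zeta>)"
    define b where "b = (if \<epsilon> > 0 then \<zeta> else \<eta>)"
    have ab: "(w - u) *\<^sub>R a + (z - w) *\<^sub>R b = 0" "norm a \<le> \<delta>" "norm b \<le> \<delta>"
    proof -
      have "(lam * \<epsilon>) *\<^sub>R \<eta> + (\<epsilon> - lam * \<epsilon>) *\<^sub>R \<zeta> = (lam * \<epsilon> - c * (1 - lam) * \<epsilon>) *\<^sub>R \<eta>"
        by (simp add: \<zeta>_eq algebra_simps)
      also have "\<dots> = 0"
        using lam by (simp add: c_def)
      finally show "(w - u) *\<^sub>R a + (z - w) *\<^sub>R b = 0"
        using \<epsilon>(2) by (auto simp: a_def b_def u_def w_def z_def min_def max_def algebra_simps)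
      show "norm a \<le> \<delta>" "norm b \<le> \<delta>"
        using \<eta> by (auto simp: a_def b_def \<zeta>_def)
    qed
    have cont: "continuous_on {u..z} xb" "continuous_on {u..z} v"
    proof -
      have "continuous_on S xb" "continuous_on S v"
        unfolding continuous_on_eq_continuous_within
        using x v has_vector_derivative_continuous by blast+
      then show "continuous_on {u..z} xb" "continuous_on {u..z} v"
        using sub continuous_on_subset by blast+
    qed
    have Lcont: "continuous_on (A \<times> UNIV \<times> UNIV) (\<lambda>(t, x, v). L t x v)"
      using L unfolding numeral_2_eq_2 by (rule Ck_on_continuous_on)
    have "integral {u..w} (\<lambda>t. L t (xb t) (v t)) + integral {w..z} (\<lambda>t. L t (xb t) (v t)) \<le>
        integral {u..w} (\<lambda>t. L t (xb t + (t - u) *\<^sub>R (\<mu> *\<^sub>R a)) (v t + \<mu> *\<^sub>R a)) +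
        integral {w..z} (\<lambda>t. L t (xb t + (t - z) *\<^sub>R (\<mu> *\<^sub>R b)) (v t + \<mu> *\<^sub>R b))"
      if "\<bar>\<mu>\<bar> \<le> 1" for \<mu>
    proof (rule weak_local_min_hat_variation[OF I(1,2) Lcont adm min u_z(1) uwz(1,2) u_z(2) uwz(3)])
      have "(w - u) *\<^sub>R (\<mu> *\<^sub>R a) + (z - w) *\<^sub>R (\<mu> *\<^sub>R b) = \<mu> *\<^sub>R ((w - u) *\<^sub>R a + (z - w) *\<^sub>R b)"
        by (simp only: scaleR_add_right scaleR_left_commute)
      then show "(w - u) *\<^sub>R (\<mu> *\<^sub>R a) + (z - w) *\<^sub>R (\<mu> *\<^sub>R b) = 0"
        by (simp add: ab(1))
      show "norm (\<mu> *\<^sub>R a) \<le> \<delta>" "norm (\<mu> *\<^sub>R b) \<le> \<delta>"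
        using mult_mono[OF that ab(2)] mult_mono[OF that ab(3)] by simp_all
      \<comment> \<open>At \<open>\<theta>\<close> itself \<open>v\<close> may be a one-sided limit
        that differs from \<open>ddt\<close>; the point is absorbed by the exceptional set.\<close>
      show "ddt {t0..t1} xb t = v t" if "t \<in> {u..z} - {\<theta>}" for t
        using that sub by (intro vb) auto
    qed auto
    note nonneg = second_variation_nonneg[OF L subset_trans[OF sub S_A] uwz(1,2) cont this]

    \<comment> \<open>These are the expansions with \<open>\<rho> = s\<close> and
      \<open>\<rho> = c * (\<epsilon> - s)\<close>; the constant terms are gone because both
      excesses vanish at \<open>\<theta>\<close>.\<close>
    define P1 where "P1 = (\<lambda>s. e1 \<theta> * s + e2 * s\<^sup>2 / 2 + s * (p \<eta> + p1 * s) + s\<^sup>2 / 2 * q \<eta>)"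
    define P2 where "P2 = (\<lambda>s. f1 \<theta> * s + f2 * s\<^sup>2 / 2 + (c * (\<epsilon> - s)) * (p \<zeta> + p1' * s) +
      (c * (\<epsilon> - s))\<^sup>2 / 2 * q \<zeta>)"
    define H1 where "H1 = (\<lambda>s. e1 \<theta> * s^2 / 2 + e2 * s^3 / 6 + p \<eta> * s^2 / 2 + p1 * s^3 / 3 + q \<eta> * s^3 / 6)"
    define H2 where "H2 = (\<lambda>s. f1 \<theta> * s^2 / 2 + f2 * s^3 / 6 - c * p \<zeta> * (\<epsilon> - s)^2 / 2 +
      c * p1' * (\<epsilon> * s^2 / 2 - s^3 / 3) - c^2 * q \<zeta> * (\<epsilon> - s)^3 / 6)"
    have H1: "((\<lambda>t. H1 (t - \<theta>)) has_field_derivative P1 (t - \<theta>)) (at t)" for t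
      unfolding H1_def P1_def
      by (auto intro!: derivative_eq_intros simp: field_simps power2_eq_square)
    have H2: "((\<lambda>t. H2 (t - \<theta>)) has_field_derivative P2 (t - \<theta>)) (at t)" for t
      unfolding H2_def P2_def
      by (auto intro!: derivative_eq_intros simp: field_simps power2_eq_square)
    define K where "K = \<kappa>' * ((2 + c^2) * \<epsilon>^2)"
    have K: "K = \<kappa> * \<epsilon>^2"
      using c2 by (simp add: K_def \<kappa>'_def)
    have R1: "\<bar>R \<theta> \<eta> t - P1 (t - \<theta>)\<bar> \<le> K" if "t \<in> {u..z}" for t
    proof -
      have "\<bar>R \<theta> \<eta> t - P1 (t - \<theta>)\<bar> \<le> \<kappa>' * ((t - \<theta>)\<^sup>2 + (t - \<theta>)\<^sup>2)"
        using r1(2)[of t "t - \<theta>"] tuz[OF that] small by (simp add: R_def Z_def P1_def)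
      also have "\<dots> \<le> \<kappa>' * ((2 + c^2) * \<epsilon>^2)"
      proof (intro mult_left_mono)
        have "(t - \<theta>)\<^sup>2 \<le> \<epsilon>\<^sup>2"
          using tuz(1)[OF that] by (simp add: abs_le_square_iff)
        moreover have "0 \<le> c\<^sup>2 * \<epsilon>\<^sup>2"
          by simp
        ultimately show "(t - \<theta>)\<^sup>2 + (t - \<theta>)\<^sup>2 \<le> (2 + c^2) * \<epsilon>^2"
          by (simp only: distrib_right)
      qed (use \<open>\<kappa>' > 0\<close> in simp)
      finally show ?thesis
        by (simp add: K_def)
    qed
    have R2: "\<bar>R (\<theta> + \<epsilon>) \<zeta> t - P2 (t - \<theta>)\<bar> \<le> K" if "t \<in> {u..z}" for t
    proof -
      define \<rho> where "\<rho> = c * (\<epsilon> - (t - \<theta>))"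
      have abs_\<rho>: "\<bar>\<rho>\<bar> \<le> c * \<bar>\<epsilon>\<bar>"
      proof -
        have "\<bar>\<epsilon> - (t - \<theta>)\<bar> \<le> \<bar>\<epsilon>\<bar>"
          using tuz(2)[OF that] by linarith
        then show ?thesis
          using \<open>c > 0\<close> by (simp add: \<rho>_def abs_mult)
      qed
      have "R (\<theta> + \<epsilon>) \<zeta> t = Z \<zeta> \<rho> t"
      proof -
        have "(t - (\<theta> + \<epsilon>)) *\<^sub>R \<zeta> = \<rho> *\<^sub>R \<eta>"
          by (simp add: \<zeta>_eq \<rho>_def algebra_simps)
        then show ?thesis
          by (simp add: R_def Z_def)
      qed
      then have "\<bar>R (\<theta> + \<epsilon>) \<zeta> t - P2 (t - \<theta>)\<bar> \<le> \<kappa>' * ((t - \<theta>)\<^sup>2 + \<rho>\<^sup>2)"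
        using r2(2)[of t \<rho>] tuz[OF that] small abs_\<rho> by (simp add: P2_def \<rho>_def)
      also have "\<dots> \<le> \<kappa>' * ((2 + c^2) * \<epsilon>^2)"
      proof (intro mult_left_mono)
        have "(t - \<theta>)\<^sup>2 \<le> \<epsilon>\<^sup>2"
          using tuz(1)[OF that] by (simp add: abs_le_square_iff)
        moreover have "\<rho>\<^sup>2 \<le> (c * \<epsilon>)\<^sup>2"
          using abs_\<rho> \<open>c > 0\<close> by (simp add: abs_mult flip: abs_le_square_iff)
        moreover have "0 \<le> \<epsilon>\<^sup>2"
          by simp
        ultimately show "(t - \<theta>)\<^sup>2 + \<rho>\<^sup>2 \<le> (2 + c^2) * \<epsilon>^2"
          unfolding distrib_right power_mult_distrib by linarith
      qed (use \<open>\<kappa>' > 0\<close> in simp)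
      finally show ?thesis
        by (simp add: K_def)
    qed
    have coeff: "(H1 (lam * \<epsilon>) - H1 0) + (H2 \<epsilon> - H2 (lam * \<epsilon>)) = \<epsilon>^2 / 2 * W + \<epsilon>^3 / 6 * G"
      unfolding H1_def H2_def c_def W G using lam by (intro hat_variation_coefficients) auto
    have uw: "{u..w} \<subseteq> {u..z}" and wz: "{w..z} \<subseteq> {u..z}"
      using uwz by auto
    have K\<epsilon>: "K * (w - u) + K * (z - w) = \<kappa> * \<bar>\<epsilon>\<bar>^3"
    proof -
      have "K * (w - u) + K * (z - w) = K * (z - u)"
        by (simp add: algebra_simps)
      also have "z - u = \<bar>\<epsilon>\<bar>"
        by (simp add: u_def z_def min_def max_def)
      also have "K * \<bar>\<epsilon>\<bar> = \<kappa> * (\<bar>\<epsilon>\<bar>^2 * \<bar>\<epsilon>\<bar>)"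
        by (simp add: K)
      also have "\<dots> = \<kappa> * \<bar>\<epsilon>\<bar>^3"
        by (simp only: power2_eq_square power3_eq_cube)
      finally show ?thesis .
    qed
    show ?thesis
    proof (cases "\<epsilon> > 0")
      case True
      then have eq: "a = \<eta>" "b = \<zeta>" "u = \<theta>" "z = \<theta> + \<epsilon>"
        by (auto simp: a_def b_def u_def z_def)
      have "\<bar>integral {u..w} (R \<theta> \<eta>) - (H1 (w - \<theta>) - H1 (u - \<theta>))\<bar> \<le> K * (w - u)"
        using uwz uw R1 H1 nonneg(1) by (intro integral_near_antiderivative) (auto simp: eq R_def)
      moreover have "\<bar>integral {w..z} (R (\<theta> + \<epsilon>) \<zeta>) - (H2 (z - \<theta>) - H2 (w - \<theta>))\<bar> \<le> K * (z - w)"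
        using uwz wz R2 H2 nonneg(2) by (intro integral_near_antiderivative) (auto simp: eq R_def)
      moreover have "0 \<le> integral {u..w} (R \<theta> \<eta>) + integral {w..z} (R (\<theta> + \<epsilon>) \<zeta>)"
        using nonneg(3) by (simp add: eq R_def)
      ultimately have "0 \<le> (H1 (w - \<theta>) - H1 (u - \<theta>)) + (H2 (z - \<theta>) - H2 (w - \<theta>)) + \<kappa> * \<bar>\<epsilon>\<bar>^3"
        using K\<epsilon> by linarith
      then show ?thesis
        using True coeff by (simp add: eq w_def)
    next
      case False
      then have eq: "a = \<zeta>" "b = \<eta>" "u = \<theta> + \<epsilon>" "z = \<theta>"
        by (auto simp: a_def b_def u_def z_def)
      have "\<bar>integral {u..w} (R (\<theta> + \<epsilon>) \<zeta>) - (H2 (w - \<theta>) - H2 (u - \<theta>))\<bar> \<le> K * (w - u)"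
        using uwz uw R2 H2 nonneg(1) by (intro integral_near_antiderivative) (auto simp: eq R_def)
      moreover have "\<bar>integral {w..z} (R \<theta> \<eta>) - (H1 (z - \<theta>) - H1 (w - \<theta>))\<bar> \<le> K * (z - w)"
        using uwz wz R1 H1 nonneg(2) by (intro integral_near_antiderivative) (auto simp: eq R_def)
      moreover have "0 \<le> integral {u..w} (R (\<theta> + \<epsilon>) \<zeta>) + integral {w..z} (R \<theta> \<eta>)"
        using nonneg(3) by (simp add: eq R_def)
      ultimately have "0 \<le> (H2 (w - \<theta>) - H2 (u - \<theta>)) + (H1 (z - \<theta>) - H1 (w - \<theta>)) + \<kappa> * \<bar>\<epsilon>\<bar>^3"
        using K\<epsilon> by linarith
      then have "0 \<le> - ((H1 (lam * \<epsilon>) - H1 0) + (H2 \<epsilon> - H2 (lam * \<epsilon>))) + \<kappa> * \<bar>\<epsilon>\<bar>^3"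
        by (simp add: eq w_def)
      then show ?thesis
        unfolding coeff using False \<epsilon>(2) by simp
    qed
  qed
  ultimately show ?thesis
    unfolding W_def G_def by blast
qed

section \<open>Signs of the coefficients of the expansion\<close>

lemma nonneg_if_nonneg_near:
  fixes V M r :: real
  assumes "r > 0" and nn: "\<And>\<epsilon>. 0 < \<epsilon> \<Longrightarrow> \<epsilon> < r \<Longrightarrow> 0 \<le> V + \<epsilon> * M"
  shows "0 \<le> V"
proof (rule tendsto_lowerbound)
  show "((\<lambda>\<epsilon>. V + \<epsilon> * M) \<longlongrightarrow> V) (at_right 0)"
    by (auto intro!: tendsto_eq_intros)
  show "\<forall>\<^sub>F \<epsilon> in at_right 0. 0 \<le> V + \<epsilon> * M"
    using nn eventually_at_right_real[OF \<open>r > 0\<close>] by (auto elim: eventually_mono)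
qed simp

text \<open>Since \<open>sgn \<epsilon> * \<epsilon>^3 = \<bar>\<epsilon>\<bar>^3\<close>, the side
  on which the hat lies drops out. Arbitrarily small \<open>\<epsilon>\<close> satisfying
  \<open>P\<close>, of whatever sign, are enough.\<close>

lemma cubic_coefficient_nonneg:
  fixes W G :: real
  assumes near: "\<And>\<kappa>. \<kappa> > 0 \<Longrightarrow> \<exists>r>0. \<forall>\<epsilon>. P \<epsilon> \<longrightarrow> \<epsilon> \<noteq> 0 \<longrightarrow> \<bar>\<epsilon>\<bar> < r \<longrightarrow>
      0 \<le> sgn \<epsilon> * (\<epsilon>^2 / 2 * W + \<epsilon>^3 / 6 * G) + \<kappa> * \<bar>\<epsilon>\<bar>^3"
    and P: "\<And>r. r > 0 \<Longrightarrow> \<exists>\<epsilon>. P \<epsilon> \<and> \<epsilon> \<noteq> 0 \<and> \<bar>\<epsilon>\<bar> < r"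
    and "W = 0"
  shows "0 \<le> G"
proof (rule ccontr)
  assume "\<not> 0 \<le> G"
  \<comment> \<open>For negative \<open>G\<close> this error constant uses up half of the cubic term
    \<open>G / 6\<close>, leaving a strictly negative bound.\<close>
  then have "- G / 12 > 0"
    by simp
  from near[OF this] obtain r where "r > 0" and r: "\<And>\<epsilon>. P \<epsilon> \<Longrightarrow> \<epsilon> \<noteq> 0 \<Longrightarrow> \<bar>\<epsilon>\<bar> < r \<Longrightarrow>
      0 \<le> sgn \<epsilon> * (\<epsilon>^2 / 2 * W + \<epsilon>^3 / 6 * G) + (- G / 12) * \<bar>\<epsilon>\<bar>^3"
    by blast
  obtain \<epsilon> where \<epsilon>: "P \<epsilon>" "\<epsilon> \<noteq> 0" "\<bar>\<epsilon>\<bar> < r"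
    using P[OF \<open>r > 0\<close>] by blast
  have "sgn \<epsilon> * \<epsilon>^3 = \<bar>\<epsilon>\<bar>^3"
    by (simp add: sgn_if abs_if power3_eq_cube)
  then have "sgn \<epsilon> * (\<epsilon>^2 / 2 * W + \<epsilon>^3 / 6 * G) = \<bar>\<epsilon>\<bar>^3 * (G / 6)"
    using \<open>W = 0\<close> by (simp flip: mult.assoc)
  with r[OF \<epsilon>] have "0 \<le> \<bar>\<epsilon>\<bar>^3 * (G / 6) + (- G / 12) * \<bar>\<epsilon>\<bar>^3"
    by (simp only:)
  then have "0 \<le> \<bar>\<epsilon>\<bar>^3 * (G / 12)"
    by (simp add: mult.commute)
  moreover have "\<bar>\<epsilon>\<bar>^3 > 0"
    using \<epsilon>(2) by simp
  ultimately show False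
    using \<open>\<not> 0 \<le> G\<close> by (simp add: zero_le_mult_iff)
qed

text \<open>The quadratic term is odd in \<open>\<epsilon>\<close>, while all other terms are of
  order \<open>\<bar>\<epsilon>\<bar>^3\<close>. After division by \<open>\<epsilon>^2\<close>,
  small \<open>\<epsilon>\<close> of the two signs bound \<open>W\<close> from both sides; a fixed
  error constant such as 1 is enough.\<close>

lemma quadratic_coefficient_zero:
  fixes W G :: real
  assumes near: "\<exists>r>0. \<forall>\<epsilon>. P \<epsilon> \<longrightarrow> \<epsilon> \<noteq> 0 \<longrightarrow> \<bar>\<epsilon>\<bar> < r \<longrightarrow>
      0 \<le> sgn \<epsilon> * (\<epsilon>^2 / 2 * W + \<epsilon>^3 / 6 * G) + \<bar>\<epsilon>\<bar>^3"
    and "s > 0" and P: "\<And>\<epsilon>. \<bar>\<epsilon>\<bar> < s \<Longrightarrow> P \<epsilon>"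
  shows "W = 0"
proof -
  obtain r where "r > 0" and r: "\<And>\<epsilon>. P \<epsilon> \<Longrightarrow> \<epsilon> \<noteq> 0 \<Longrightarrow> \<bar>\<epsilon>\<bar> < r \<Longrightarrow>
      0 \<le> sgn \<epsilon> * (\<epsilon>^2 / 2 * W + \<epsilon>^3 / 6 * G) + \<bar>\<epsilon>\<bar>^3"
    using near by blast
  have "0 \<le> W / 2 + \<epsilon> * (G / 6 + 1)" "0 \<le> - W / 2 + \<epsilon> * (G / 6 + 1)"
    if "0 < \<epsilon>" "\<epsilon> < min r s" for \<epsilon>
  proof -
    have "0 \<le> \<epsilon>^2 * (W / 2 + \<epsilon> * (G / 6 + 1))"
      using r[of \<epsilon>] P[of \<epsilon>] that by (simp add: algebra_simps power2_eq_square power3_eq_cube)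
    then show "0 \<le> W / 2 + \<epsilon> * (G / 6 + 1)"
      using that by (simp add: zero_le_mult_iff)
    have "0 \<le> \<epsilon>^2 * (- W / 2 + \<epsilon> * (G / 6 + 1))"
      using r[of "- \<epsilon>"] P[of "- \<epsilon>"] that by (simp add: algebra_simps power2_eq_square power3_eq_cube)
    then show "0 \<le> - W / 2 + \<epsilon> * (G / 6 + 1)"
      using that by (simp add: zero_le_mult_iff)
  qed
  then have "0 \<le> W / 2" "0 \<le> - W / 2"
    using \<open>r > 0\<close> \<open>s > 0\<close> nonneg_if_nonneg_near[of "min r s"] by (metis min_less_iff_conj)+
  then show ?thesis
    by simp
qed

section \<open>The one-sided and two-sided necessary conditions\<close>

theorem theorem3p5:
  fixes L :: "'n::finite lagrangian"
    and a b :: ereal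
    and t0 t1 :: real
    and x0 x1 :: "real^'n"
    and xb :: "real \<Rightarrow> real^'n"
  defines "vb \<equiv> ddt {t0..t1} xb"
  assumes "t0 < t1" and "{t0..t1} \<subseteq> einterval a b"
    and "Ck_on 1 (\<lambda>(t, x, v). L t x v) (einterval a b \<times> UNIV \<times> UNIV)"
    and "Ck_on 2 (\<lambda>(t, x, v). L t x v) (einterval a b \<times> UNIV \<times> UNIV)"
    and "Ck_on 2 (\<lambda>(t, x, v). L_v L t x v) (einterval a b \<times> UNIV \<times> UNIV)"
    and "weak_local_min L t0 t1 x0 x1 xb"
  shows "\<exists>\<delta>>0.
    (\<forall>\<theta>\<in>{t0..<t1}. \<forall>\<alpha>>0. {\<theta>..<\<theta>+\<alpha>} \<subseteq> {t0..t1} \<longrightarrow>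
       thrice_differentiable_on xb {\<theta>..<\<theta>+\<alpha>} \<longrightarrow>
       (\<forall>\<eta>. \<forall>lam\<in>{0<..<1}.
          \<eta> \<in> cball 0 \<delta> \<longrightarrow> (lam / (lam - 1)) *\<^sub>R \<eta> \<in> cball 0 \<delta> \<longrightarrow>
          E_fun L xb (right_val vb \<theta>) \<theta> \<eta> = 0 \<longrightarrow>
          E_fun L xb (right_val vb \<theta>) \<theta> ((lam / (lam - 1)) *\<^sub>R \<eta>) = 0 \<longrightarrow>
          W_fun {\<theta>..} L xb (right_val vb \<theta>) \<theta> lam \<eta> = 0 \<longrightarrow>
          G_fun {\<theta>..} L xb (right_val vb \<theta>) \<theta> lam \<eta> \<ge> 0)) \<and>
    (\<forall>\<theta>\<in>{t0<..t1}. \<forall>\<alpha>>0. {\<theta>-\<alpha><..\<theta>} \<subseteq> {t0..t1} \<longrightarrow>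
       thrice_differentiable_on xb {\<theta>-\<alpha><..\<theta>} \<longrightarrow>
       (\<forall>\<eta>. \<forall>lam\<in>{0<..<1}.
          \<eta> \<in> cball 0 \<delta> \<longrightarrow> (lam / (lam - 1)) *\<^sub>R \<eta> \<in> cball 0 \<delta> \<longrightarrow>
          E_fun L xb (left_val vb \<theta>) \<theta> \<eta> = 0 \<longrightarrow>
          E_fun L xb (left_val vb \<theta>) \<theta> ((lam / (lam - 1)) *\<^sub>R \<eta>) = 0 \<longrightarrow>
          W_fun {..\<theta>} L xb (left_val vb \<theta>) \<theta> lam \<eta> = 0 \<longrightarrow>
          G_fun {..\<theta>} L xb (left_val vb \<theta>) \<theta> lam \<eta> \<ge> 0)) \<and>
    (\<forall>\<theta>\<in>{t0<..<t1}.
       thrice_differentiable_at xb \<theta> \<longrightarrow>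
       (\<forall>\<eta>. \<forall>lam\<in>{0<..<1}.
          \<eta> \<in> cball 0 \<delta> \<longrightarrow> (lam / (lam - 1)) *\<^sub>R \<eta> \<in> cball 0 \<delta> \<longrightarrow>
          E_fun L xb vb \<theta> \<eta> = 0 \<longrightarrow>
          E_fun L xb vb \<theta> ((lam / (lam - 1)) *\<^sub>R \<eta>) = 0 \<longrightarrow>
          G_fun UNIV L xb vb \<theta> lam \<eta> \<ge> 0))"
proof -
  obtain \<delta> where "\<delta> > 0" and adm: "admissible t0 t1 x0 x1 xb"
    and min: "\<And>x. admissible t0 t1 x0 x1 x \<Longrightarrow>
        max (C_norm t0 t1 (\<lambda>t. x t - xb t))
            (Linf_norm t0 t1 (\<lambda>t. ddt {t0..t1} x t - ddt {t0..t1} xb t)) \<le> ereal \<delta> \<Longrightarrow>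
        J L t0 t1 x \<ge> J L t0 t1 xb"
    using assms(7) unfolding weak_local_min_def by blast
  note third_order = weak_local_min_third_order[OF assms(2,3) open_einterval assms(5,6) adm min]
  have ddt_eq: "vb t = d" if "(xb has_vector_derivative d) (at t)" "t \<in> {t0..t1}" for t d
    using that vector_derivative_within_closed_interval[OF \<open>t0 < t1\<close>] has_vector_derivative_at_within
    unfolding vb_def ddt_def by blast

  have "G_fun {\<theta>..} L xb (right_val vb \<theta>) \<theta> lam \<eta> \<ge> 0"
    if "\<alpha> > 0" and sub: "{\<theta>..<\<theta>+\<alpha>} \<subseteq> {t0..t1}"
      and diff: "thrice_differentiable_on xb {\<theta>..<\<theta>+\<alpha>}"
      and lam: "lam \<in> {0<..<1}" and \<eta>: "\<eta> \<in> cball 0 \<delta>" "(lam / (lam - 1)) *\<^sub>R \<eta> \<in> cball 0 \<delta>"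
      and E: "E_fun L xb (right_val vb \<theta>) \<theta> \<eta> = 0"
        "E_fun L xb (right_val vb \<theta>) \<theta> ((lam / (lam - 1)) *\<^sub>R \<eta>) = 0"
      and W: "W_fun {\<theta>..} L xb (right_val vb \<theta>) \<theta> lam \<eta> = 0"
    for \<theta> \<alpha> lam \<eta>
  proof -
    let ?S = "{\<theta>..<\<theta>+\<alpha>}" and ?v = "right_val vb \<theta>"
    have \<theta>: "\<theta> \<in> ?S"
      using \<open>\<alpha> > 0\<close> by simp
    obtain d1 d2 d3 where d: "\<And>t. t \<in> ?S \<Longrightarrow> (xb has_vector_derivative d1 t) (at t within ?S)"
      "\<And>t. t \<in> ?S \<Longrightarrow> (d1 has_vector_derivative d2 t) (at t within ?S)"
      "\<And>t. t \<in> ?S \<Longrightarrow> (d2 has_vector_derivative d3 t) (at t within ?S)"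
      using diff unfolding thrice_differentiable_on_def by blast
    have vb: "vb t = d1 t" if "t \<in> ?S" "t \<noteq> \<theta>" for t
    proof (rule ddt_eq)
      have "at t within ?S = at t"
        by (rule at_within_nhd[of t "{\<theta><..<\<theta>+\<alpha>}"]) (use that in auto)
      then show "(xb has_vector_derivative d1 t) (at t)"
        using d(1)[OF that(1)] by simp
    qed (use that sub in blast)
    \<comment> \<open>\<open>\<theta>\<close> may be an angular point, where
      \<open>vb \<theta>\<close> tells nothing. Continuity of \<open>d1\<close> at
      \<open>\<theta>\<close> identifies the right limit of \<open>vb\<close> with
      \<open>d1 \<theta>\<close>, so \<open>right_val vb \<theta>\<close> is the derivative on all
      of \<open>?S\<close>, including \<open>\<theta>\<close>.\<close>
    have "(d1 \<longlongrightarrow> d1 \<theta>) (at \<theta> within ?S)"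
      using has_vector_derivative_continuous[OF d(2)[OF \<theta>]] by (simp add: continuous_within)
    moreover have "\<forall>\<^sub>F t in at \<theta> within ?S. d1 t = vb t"
      using vb by (auto simp: eventually_at_filter)
    ultimately have "(vb \<longlongrightarrow> d1 \<theta>) (at \<theta> within ?S)"
      by (rule Lim_transform_eventually)
    moreover have "at \<theta> within ?S = at_right \<theta>"
      by (rule at_within_nhd[of \<theta> "{..<\<theta>+\<alpha>}"]) (use \<open>\<alpha> > 0\<close> in auto)
    ultimately have "Lim (at_right \<theta>) vb = d1 \<theta>"
      by (intro tendsto_Lim) simp_all
    then have v: "?v t = d1 t" if "t \<in> ?S" for t
      using vb that by (simp add: right_val_def)
    have T: "at t within {\<theta>..} = at t within ?S" if "t \<in> ?S" for t
      by (rule at_within_nhd[of t "{..<\<theta>+\<alpha>}"]) (use that in auto)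
    have nb: "at t within ?S \<noteq> bot" if "t \<in> ?S" for t
      using that by (simp add: trivial_limit_within islimpt_Ico)
    show ?thesis
    proof (rule cubic_coefficient_nonneg[OF third_order])
      show "convex ?S" "\<theta> \<in> ?S" "?S \<subseteq> {t0..t1}"
        using \<theta> sub by auto
      show "(xb has_vector_derivative ?v t) (at t within ?S)" if "t \<in> ?S" for t
        using d(1)[OF that] v[OF that] by simp
      show "(?v has_vector_derivative d2 t) (at t within ?S)" if "t \<in> ?S" for t
        using that v d(2)[OF that] by (rule has_vector_derivative_transform)
      show "ddt {t0..t1} xb t = ?v t" if "t \<in> ?S" "t \<noteq> \<theta>" for t
        using that by (simp add: right_val_def vb_def)
      show "\<exists>\<epsilon>. \<theta> + \<epsilon> \<in> ?S \<and> \<epsilon> \<noteq> 0 \<and> \<bar>\<epsilon>\<bar> < r" if "r > 0" for r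
        \<comment> \<open>Halving keeps the point strictly inside the half-open interval and below
          \<open>r\<close>.\<close>
        using that \<open>\<alpha> > 0\<close> by (intro exI[of _ "min \<alpha> r / 2"]) auto
    qed (use T nb d(3)[OF \<theta>] lam \<eta> E W in auto)
  qed
  moreover have "G_fun {..\<theta>} L xb (left_val vb \<theta>) \<theta> lam \<eta> \<ge> 0"
    if "\<alpha> > 0" and sub: "{\<theta>-\<alpha><..\<theta>} \<subseteq> {t0..t1}"
      and diff: "thrice_differentiable_on xb {\<theta>-\<alpha><..\<theta>}"
      and lam: "lam \<in> {0<..<1}" and \<eta>: "\<eta> \<in> cball 0 \<delta>" "(lam / (lam - 1)) *\<^sub>R \<eta> \<in> cball 0 \<delta>"
      and E: "E_fun L xb (left_val vb \<theta>) \<theta> \<eta> = 0"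
        "E_fun L xb (left_val vb \<theta>) \<theta> ((lam / (lam - 1)) *\<^sub>R \<eta>) = 0"
      and W: "W_fun {..\<theta>} L xb (left_val vb \<theta>) \<theta> lam \<eta> = 0"
    for \<theta> \<alpha> lam \<eta>
  proof -
    let ?S = "{\<theta>-\<alpha><..\<theta>}" and ?v = "left_val vb \<theta>"
    have \<theta>: "\<theta> \<in> ?S"
      using \<open>\<alpha> > 0\<close> by simp
    obtain d1 d2 d3 where d: "\<And>t. t \<in> ?S \<Longrightarrow> (xb has_vector_derivative d1 t) (at t within ?S)"
      "\<And>t. t \<in> ?S \<Longrightarrow> (d1 has_vector_derivative d2 t) (at t within ?S)"
      "\<And>t. t \<in> ?S \<Longrightarrow> (d2 has_vector_derivative d3 t) (at t within ?S)"
      using diff unfolding thrice_differentiable_on_def by blast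
    have vb: "vb t = d1 t" if "t \<in> ?S" "t \<noteq> \<theta>" for t
    proof (rule ddt_eq)
      have "at t within ?S = at t"
        by (rule at_within_nhd[of t "{\<theta>-\<alpha><..<\<theta>}"]) (use that in auto)
      then show "(xb has_vector_derivative d1 t) (at t)"
        using d(1)[OF that(1)] by simp
    qed (use that sub in blast)
    have "(d1 \<longlongrightarrow> d1 \<theta>) (at \<theta> within ?S)"
      using has_vector_derivative_continuous[OF d(2)[OF \<theta>]] by (simp add: continuous_within)
    moreover have "\<forall>\<^sub>F t in at \<theta> within ?S. d1 t = vb t"
      using vb by (auto simp: eventually_at_filter)
    ultimately have "(vb \<longlongrightarrow> d1 \<theta>) (at \<theta> within ?S)"
      by (rule Lim_transform_eventually)
    moreover have "at \<theta> within ?S = at_left \<theta>"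
      by (rule at_within_nhd[of \<theta> "{\<theta>-\<alpha><..}"]) (use \<open>\<alpha> > 0\<close> in auto)
    ultimately have "Lim (at_left \<theta>) vb = d1 \<theta>"
      by (intro tendsto_Lim) simp_all
    then have v: "?v t = d1 t" if "t \<in> ?S" for t
      using vb that by (simp add: left_val_def)
    have T: "at t within {..\<theta>} = at t within ?S" if "t \<in> ?S" for t
      by (rule at_within_nhd[of t "{\<theta>-\<alpha><..}"]) (use that in auto)
    have nb: "at t within ?S \<noteq> bot" if "t \<in> ?S" for t
      using that by (simp add: trivial_limit_within islimpt_Ioc)
    show ?thesis
    proof (rule cubic_coefficient_nonneg[OF third_order])
      show "convex ?S" "\<theta> \<in> ?S" "?S \<subseteq> {t0..t1}"
        using \<theta> sub by auto
      show "(xb has_vector_derivative ?v t) (at t within ?S)" if "t \<in> ?S" for t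
        using d(1)[OF that] v[OF that] by simp
      show "(?v has_vector_derivative d2 t) (at t within ?S)" if "t \<in> ?S" for t
        using that v d(2)[OF that] by (rule has_vector_derivative_transform)
      show "ddt {t0..t1} xb t = ?v t" if "t \<in> ?S" "t \<noteq> \<theta>" for t
        using that by (simp add: left_val_def vb_def)
      show "\<exists>\<epsilon>. \<theta> + \<epsilon> \<in> ?S \<and> \<epsilon> \<noteq> 0 \<and> \<bar>\<epsilon>\<bar> < r" if "r > 0" for r
        using that \<open>\<alpha> > 0\<close> by (intro exI[of _ "- (min \<alpha> r / 2)"]) auto
    qed (use T nb d(3)[OF \<theta>] lam \<eta> E W in auto)
  qed
  moreover have "G_fun UNIV L xb vb \<theta> lam \<eta> \<ge> 0"
    if \<theta>_in: "\<theta> \<in> {t0<..<t1}" and diff: "thrice_differentiable_at xb \<theta>"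
      and lam: "lam \<in> {0<..<1}" and \<eta>: "\<eta> \<in> cball 0 \<delta>" "(lam / (lam - 1)) *\<^sub>R \<eta> \<in> cball 0 \<delta>"
      and E: "E_fun L xb vb \<theta> \<eta> = 0" "E_fun L xb vb \<theta> ((lam / (lam - 1)) *\<^sub>R \<eta>) = 0"
    for \<theta> lam \<eta>
  proof -
    obtain d1 d2 d3 where "\<forall>\<^sub>F t in nhds \<theta>. (xb has_vector_derivative d1 t) (at t) \<and>
        (d1 has_vector_derivative d2 t) (at t)" and d3: "(d2 has_vector_derivative d3) (at \<theta>)"
      using diff unfolding thrice_differentiable_at_def by blast
    then obtain r0 where r0: "r0 > 0" "\<And>t. dist t \<theta> < r0 \<Longrightarrow>
        (xb has_vector_derivative d1 t) (at t) \<and> (d1 has_vector_derivative d2 t) (at t)"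
      unfolding eventually_nhds_metric by blast
    \<comment> \<open>The radius keeps the ball inside the interval and inside the neighborhood
      where the first two derivatives exist, so \<open>vb\<close> equals \<open>d1\<close> on the
      ball, also at \<open>\<theta>\<close>.\<close>
    define s where "s = min r0 (min (\<theta> - t0) (t1 - \<theta>))"
    have "s > 0"
      using r0(1) \<theta>_in by (simp add: s_def)
    let ?S = "ball \<theta> s"
    have d: "(xb has_vector_derivative d1 t) (at t within ?S)" "(d1 has_vector_derivative d2 t) (at t within ?S)"
      and vb: "vb t = d1 t" if "t \<in> ?S" for t
    proof -
      have t: "dist t \<theta> < r0" "t \<in> {t0..t1}"
        using that by (auto simp: s_def dist_real_def abs_minus_commute)
      show "(xb has_vector_derivative d1 t) (at t within ?S)" "(d1 has_vector_derivative d2 t) (at t within ?S)"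
        "vb t = d1 t"
        using r0(2)[OF t(1)] ddt_eq[OF _ t(2)] by (auto intro: has_vector_derivative_at_within)
    qed
    have coeffs: "\<exists>r>0. \<forall>\<epsilon>. \<theta> + \<epsilon> \<in> ?S \<longrightarrow> \<epsilon> \<noteq> 0 \<longrightarrow> \<bar>\<epsilon>\<bar> < r \<longrightarrow>
      0 \<le> sgn \<epsilon> * (\<epsilon>^2 / 2 * W_fun UNIV L xb vb \<theta> lam \<eta> + \<epsilon>^3 / 6 * G_fun UNIV L xb vb \<theta> lam \<eta>) +
        \<kappa> * \<bar>\<epsilon>\<bar>^3" if "\<kappa> > 0" for \<kappa>
    proof (rule third_order)
      show "?S \<subseteq> {t0..t1}"
        by (auto simp: s_def dist_real_def)
      show "at t within UNIV = at t within ?S" "at t within ?S \<noteq> bot" if "t \<in> ?S" for t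
        using at_within_open[OF that] by simp_all
      show "(xb has_vector_derivative vb t) (at t within ?S)" if "t \<in> ?S" for t
        using d(1)[OF that] vb[OF that] by simp
      show "(vb has_vector_derivative d2 t) (at t within ?S)" if "t \<in> ?S" for t
        using that vb d(2)[OF that] by (rule has_vector_derivative_transform)
      show "(d2 has_vector_derivative d3) (at \<theta> within ?S)"
        using d3 by (rule has_vector_derivative_at_within)
    qed (use \<open>s > 0\<close> lam \<eta> E that in \<open>auto simp: vb_def\<close>)
    have "W_fun UNIV L xb vb \<theta> lam \<eta> = 0"
      using coeffs[of 1] \<open>s > 0\<close>
      by (intro quadratic_coefficient_zero[where P = "\<lambda>\<epsilon>. \<theta> + \<epsilon> \<in> ?S"]) (auto simp: dist_real_def)
    moreover have "\<exists>\<epsilon>. \<theta> + \<epsilon> \<in> ?S \<and> \<epsilon> \<noteq> 0 \<and> \<bar>\<epsilon>\<bar> < r" if "r > 0" for r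
      using that \<open>s > 0\<close> by (intro exI[of _ "min s r / 2"]) (auto simp: dist_real_def)
    ultimately show ?thesis
      by (intro cubic_coefficient_nonneg[OF coeffs])
  qed
  ultimately show ?thesis
    using \<open>\<delta> > 0\<close> by blast
qed

end
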